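(* If $X$ is a Peano continuum and $G$ is a countable inverse limit slender group, then there are only countably many homomorphisms from the first shape group $\check\pi_1(X)$ to $G$.
   Context: A Peano continuum is a compact, connected, locally connected metric space. Every Peano continuum $X$ is the limit $X=\varprojlim(X_i,p_i^j)$ of an inverse sequence of finite polyhedra $X_i$, with projections $p_i\colon X\to X_i$. For a base point $x_0\in X$, the first shape group (shape fundamental group) is $\check\pi_1(X)=\check\pi_1(X,x_0):=\varprojlim\pi_1(X_i,p_i(x_0))$, the inverse limit being taken with respect to the homomorphisms induced by the bonding maps; it does not depend, up to isomorphism, on the chosen inverse sequence. An inverse sequence of groups $(H_i,p_i^j)$ (homomorphisms $p_i^j\colon H_j\to H_i$ for $i<j$ with $p_i^jp_j^k=p_i^k$) satisfies the Mittag-Leffler condition if for every $i$ there is $j>i$ with $p_i^k(H_k)=p_i^j(H_j)$ for all $k\ge j$. A group $G$ (not necessarily abelian) is inverse limit slender if for every Mittag-Leffler inverse sequence of groups and every homomorphism $\varphi\colon\varprojlim H_i\to G$ there exist $i$ and a homomorphism $\overline\varphi\colon H_i\to G$ with $\varphi=\overline\varphi\circ p_i$, where $p_i\colon\varprojlim H_i\to H_i$ is the projection. *)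

theory Defs
  imports
    "HOL-Analysis.Analysis"
    "HOL-Algebra.Product_Groups"
    "HOL-Library.Infinite_Typeclass"
begin

section \<open>Peano continua as inverse limits of finite polyhedra\<close>

definition peano_continuum :: "'a::metric_space set \<Rightarrow> bool" where
  "peano_continuum X \<longleftrightarrow> compact X \<and> connected X \<and> locally connected X"

definition finite_simplicial_complex :: "nat set set \<Rightarrow> bool" where
  "finite_simplicial_complex K \<longleftrightarrow> finite K \<and>
     (\<forall>s\<in>K. finite s \<and> s \<noteq> {} \<and> (\<forall>t. t \<noteq> {} \<and> t \<subseteq> s \<longrightarrow> t \<in> K))"

text \<open>Points are given by their barycentric coordinates. As only finitely many vertices occur,
  the product topology on \<^typ>\<open>nat \<Rightarrow> real\<close> induces the usual topology of a finite complex.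
  Realizing all complexes in this one type puts no bound on their dimensions.\<close>

definition geometric_realization :: "nat set set \<Rightarrow> (nat \<Rightarrow> real) set" where
  "geometric_realization K =
     {t. (\<forall>v. 0 \<le> t v) \<and> {v. t v \<noteq> 0} \<in> K \<and> (\<Sum>v | t v \<noteq> 0. t v) = 1}"

definition finite_polyhedron :: "'b::topological_space set \<Rightarrow> bool" where
  "finite_polyhedron P \<longleftrightarrow>
     (\<exists>K. finite_simplicial_complex K \<and> P homeomorphic geometric_realization K)"

text \<open>In an inverse sequence of spaces or groups, \<open>p i j\<close> is the bonding map from the
  \<open>j\<close>-th term to the \<open>i\<close>-th one; only its values for \<open>i < j\<close> matter.\<close>

definition inverse_sequence_spaces ::
    "(nat \<Rightarrow> 'b::topological_space set) \<Rightarrow> (nat \<Rightarrow> nat \<Rightarrow> 'b \<Rightarrow> 'b) \<Rightarrow> bool" where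
  "inverse_sequence_spaces P p \<longleftrightarrow>
     (\<forall>i j. i < j \<longrightarrow> continuous_on (P j) (p i j) \<and> p i j ` P j \<subseteq> P i) \<and>
     (\<forall>i j k. i < j \<longrightarrow> j < k \<longrightarrow> (\<forall>x\<in>P k. p i j (p j k x) = p i k x))"

definition inverse_limit_space ::
    "(nat \<Rightarrow> 'b set) \<Rightarrow> (nat \<Rightarrow> nat \<Rightarrow> 'b \<Rightarrow> 'b) \<Rightarrow> (nat \<Rightarrow> 'b) set" where
  "inverse_limit_space P p =
     {x. (\<forall>i. x i \<in> P i) \<and> (\<forall>i j. i < j \<longrightarrow> p i j (x j) = x i)}"

text \<open>\<open>X\<close> is the limit of the inverse sequence, with projections \<open>q i\<close>.\<close>

definition is_inverse_limit ::
    "'a::topological_space set \<Rightarrow> (nat \<Rightarrow> 'a \<Rightarrow> 'b::topological_space) \<Rightarrow>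
     (nat \<Rightarrow> 'b set) \<Rightarrow> (nat \<Rightarrow> nat \<Rightarrow> 'b \<Rightarrow> 'b) \<Rightarrow> bool" where
  "is_inverse_limit X q P p \<longleftrightarrow>
     (\<exists>r. homeomorphism X (inverse_limit_space P p) (\<lambda>x i. q i x) r)"

section \<open>Fundamental groups\<close>

definition loops_at :: "'a::topological_space set \<Rightarrow> 'a \<Rightarrow> (real \<Rightarrow> 'a) set" where
  "loops_at S x =
     {g. path g \<and> path_image g \<subseteq> S \<and> pathstart g = x \<and> pathfinish g = x}"

definition fundamental_group ::
    "'a::topological_space set \<Rightarrow> 'a \<Rightarrow> (real \<Rightarrow> 'a) set monoid" where
  "fundamental_group S x =
     \<lparr>carrier = loops_at S x // {(g, h). homotopic_paths S g h},
      monoid.mult = (\<lambda>A B. {r. \<exists>g\<in>A. \<exists>h\<in>B. homotopic_paths S (g +++ h) r}),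
      one = {r. homotopic_paths S (\<lambda>_. x) r}\<rparr>"

text \<open>The map on homotopy classes induced by a map \<open>f\<close> into \<open>T\<close>.\<close>

definition induced_map ::
    "'b::topological_space set \<Rightarrow> ('a \<Rightarrow> 'b) \<Rightarrow> (real \<Rightarrow> 'a) set \<Rightarrow> (real \<Rightarrow> 'b) set" where
  "induced_map T f A = {r. \<exists>g\<in>A. homotopic_paths T (f \<circ> g) r}"

section \<open>Inverse sequences of groups\<close>

definition inverse_sequence_groups ::
    "(nat \<Rightarrow> 'h monoid) \<Rightarrow> (nat \<Rightarrow> nat \<Rightarrow> 'h \<Rightarrow> 'h) \<Rightarrow> bool" where
  "inverse_sequence_groups H p \<longleftrightarrow>
     (\<forall>i. group (H i)) \<and>
     (\<forall>i j. i < j \<longrightarrow> p i j \<in> hom (H j) (H i)) \<and>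
     (\<forall>i j k. i < j \<longrightarrow> j < k \<longrightarrow> (\<forall>x\<in>carrier (H k). p i j (p j k x) = p i k x))"

definition inverse_limit_group ::
    "(nat \<Rightarrow> 'h monoid) \<Rightarrow> (nat \<Rightarrow> nat \<Rightarrow> 'h \<Rightarrow> 'h) \<Rightarrow> (nat \<Rightarrow> 'h) monoid" where
  "inverse_limit_group H p =
     (product_group UNIV H)
       \<lparr>carrier := {x \<in> carrier (product_group UNIV H). \<forall>i j. i < j \<longrightarrow> p i j (x j) = x i}\<rparr>"

definition mittag_leffler ::
    "(nat \<Rightarrow> 'h monoid) \<Rightarrow> (nat \<Rightarrow> nat \<Rightarrow> 'h \<Rightarrow> 'h) \<Rightarrow> bool" where
  "mittag_leffler H p \<longleftrightarrow>
     (\<forall>i. \<exists>j>i. \<forall>k\<ge>j. p i k ` carrier (H k) = p i j ` carrier (H j))"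

text \<open>A definition cannot quantify over types, so the type \<open>'h\<close> that carries the groups of the
  inverse sequences is a parameter. Slenderness in the ordinary sense, with respect to groups of
  arbitrary size, yields this property for every \<open>'h\<close>. For infinite \<open>'h\<close> the converse also holds:
  if \<open>\<phi>\<close> factors through no \<open>p i\<close>, choose \<open>x i\<close> in the kernel of \<open>p i\<close> with \<open>\<phi> (x i) \<noteq> \<one>\<close>;
  sending the \<open>i\<close>-th generator to \<open>x i\<close> pulls \<open>\<phi>\<close> back to a homomorphism on the limit of the
  free groups on \<open>n\<close> generators, which factors through none of these countable groups.\<close>

definition inverse_limit_slender :: "'h itself \<Rightarrow> ('g, 'm) monoid_scheme \<Rightarrow> bool" where
  "inverse_limit_slender (U :: 'h itself) G \<longleftrightarrow>
     (\<forall>(H :: nat \<Rightarrow> 'h monoid) p. inverse_sequence_groups H p \<and> mittag_leffler H p \<longrightarrow>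
        (\<forall>\<phi> \<in> hom (inverse_limit_group H p) G.
           \<exists>i. \<exists>\<psi> \<in> hom (H i) G. \<forall>x \<in> carrier (inverse_limit_group H p). \<phi> x = \<psi> (x i)))"

section \<open>The first shape group\<close>

definition first_shape_group ::
    "(nat \<Rightarrow> 'b::topological_space set) \<Rightarrow> (nat \<Rightarrow> nat \<Rightarrow> 'b \<Rightarrow> 'b) \<Rightarrow>
     (nat \<Rightarrow> 'a \<Rightarrow> 'b) \<Rightarrow> 'a \<Rightarrow> (nat \<Rightarrow> (real \<Rightarrow> 'b) set) monoid" where
  "first_shape_group P p q x0 =
     inverse_limit_group (\<lambda>i. fundamental_group (P i) (q i x0)) (\<lambda>i j. induced_map (P i) (p i j))"

text \<open>Functions in \<^const>\<open>hom\<close> are arbitrary outside the carrier of the source, so homomorphisms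
  are counted through their extensional representatives.\<close>

definition homomorphisms ::
    "('h, 'n) monoid_scheme \<Rightarrow> ('g, 'm) monoid_scheme \<Rightarrow> ('h \<Rightarrow> 'g) set" where
  "homomorphisms H G = hom H G \<inter> extensional (carrier H)"

end

theory Submission
  imports
    Defs
    "HOL-Algebra.Weak_Morphisms"
    "HOL-Algebra.Generated_Groups"
begin

text \<open>For every \<open>i\<close> there is \<open>j > i\<close> such that, for each \<open>l \<ge> j\<close>, the image of \<open>\<pi>\<^sub>1(P j)\<close> in \<open>\<pi>\<^sub>1(P i)\<close>
  lies in the image of a finitely generated subgroup of \<open>\<pi>\<^sub>1(P l)\<close>: if \<open>j\<close> is large, a loop in \<open>P j\<close>
  runs close to a finite set of points of \<open>X\<close>, consecutive ones lying in a common small connected subset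
  of \<open>X\<close>. The image of that set in \<open>P l\<close> is connected, so the points can be joined there by paths with
  small image in \<open>P i\<close>, and in a polyhedron close loops are homotopic. No arcs in \<open>X\<close> are needed.

  Hence the sequence of fundamental groups satisfies the Mittag-Leffler condition with finitely generated
  stable images \<open>M i\<close>, and its limit is also the limit of the \<open>M i\<close>. By slenderness every homomorphism
  to \<open>G\<close> factors through some \<open>M i\<close>, which has only countably many homomorphisms to \<open>G\<close>.\<close>

section \<open>Limits of inverse sequences of groups\<close>

text \<open>Bonding maps need not lift paths, so a loop in \<open>P j\<close> cannot simply be moved
  to a later \<open>P l\<close>. Points of \<open>X\<close> have compatible images at all levels; a
  chain of them that shadows the loop can therefore be realised in every \<open>P l\<close>. The
  points are drawn from a finite set fixed before \<open>l\<close> and before the loop, so only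
  finitely many kinds of steps occur, and closing up each step by tails to the base point gives
  finitely many generators for all loops at once.

  Two features of the setting shape the rest. The spaces \<open>P i\<close> carry a topology only,
  so all uniform estimates are made in embeddings into \<open>nat \<Rightarrow> real\<close>.
  Slenderness is given for groups on one infinite type, while fundamental groups consist of sets of
  paths; the stable images, being finitely generated, are countable and can be copied into that
  type, so the passage to them comes before slenderness is applied.\<close>

lemma countable_generate:
  assumes "countable S"
  shows "countable (generate G S)"
proof -
  define step where "step A = A \<union> (\<lambda>(x, y). x \<otimes>\<^bsub>G\<^esub> y) ` (A \<times> A)" for A
  \<comment> \<open>In \<open>generate\<close> the rule for inverses applies to generators only. So
    inverses enter the initial set, and only products are iterated.\<close>
  define B where "B n = (step ^^ n) (insert \<one>\<^bsub>G\<^esub> (S \<union> (\<lambda>x. inv\<^bsub>G\<^esub> x) ` S))" for n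
  have Suc: "B (Suc n) = step (B n)" for n
    by (simp add: B_def)
  have "countable (B n)" for n
  proof (induction n)
    case 0
    then show ?case using assms by (simp add: B_def)
  next
    case (Suc n)
    then show ?case unfolding \<open>B (Suc n) = step (B n)\<close> step_def
      by (intro countable_Un countable_image countable_SIGMA)
  qed
  moreover have mono: "B m \<subseteq> B n" if "m \<le> n" for m n
    by (rule lift_Suc_mono_le[OF _ that]) (auto simp: Suc step_def)
  have "x \<in> (\<Union>n. B n)" if "x \<in> generate G S" for x
    using that
  proof induction
    case (eng x y)
    then obtain m n where mn: "x \<in> B m" "y \<in> B n" by auto
    then have "x \<in> B (max m n)" "y \<in> B (max m n)"
      using mono[of m "max m n"] mono[of n "max m n"] by auto
    then have "x \<otimes>\<^bsub>G\<^esub> y \<in> B (Suc (max m n))"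
      by (auto simp: Suc step_def)
    then show ?case by blast
  qed (auto simp: B_def intro!: exI[of _ 0])
  ultimately show ?thesis
    using countable_subset[of "generate G S" "\<Union>n. B n"] by blast
qed

lemma hom_eq_on_generate:
  assumes "group H" "group G" "f \<in> hom H G" "g \<in> hom H G" "S \<subseteq> carrier H"
    and eq: "\<And>x. x \<in> S \<Longrightarrow> f x = g x" and "x \<in> generate H S"
  shows "f x = g x"
proof -
  interpret f: group_hom H G f using assms by (simp add: group_hom_def group_hom_axioms_def)
  interpret g: group_hom H G g using assms by (simp add: group_hom_def group_hom_axioms_def)
  show ?thesis
    using assms(7)
  proof induction
    case (inv h)
    then show ?case using eq[of h] assms(5) by (metis f.hom_inv g.hom_inv subsetD)
  next
    case (eng x y)
    then show ?case using f.G.generate_in_carrier[OF assms(5)] by simp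
  qed (use eq in simp_all)
qed

text \<open>A homomorphism is determined by its values on generators, and finiteness of
  \<open>S\<close> keeps the set of possible restrictions to \<open>S\<close> countable.\<close>

lemma countable_homomorphisms_finitely_generated:
  assumes "group H" "group G" "countable (carrier G)" "finite S" "S \<subseteq> carrier H"
    and gen: "carrier H = generate H S"
  shows "countable (homomorphisms H G)"
proof (rule countable_image_inj_on)
  have "(\<lambda>f. restrict f S) ` homomorphisms H G \<subseteq> S \<rightarrow>\<^sub>E carrier G"
    using assms(5) by (auto simp: homomorphisms_def hom_def)
  then show "countable ((\<lambda>f. restrict f S) ` homomorphisms H G)"
    using assms(3,4) by (meson countable_PiE countable_subset)
  show "inj_on (\<lambda>f. restrict f S) (homomorphisms H G)"
  proof (rule inj_onI)
    fix f g assume fg: "f \<in> homomorphisms H G" "g \<in> homomorphisms H G" "restrict f S = restrict g S"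
    then have "f x = g x" if "x \<in> S" for x
      using that by (metis restrict_apply')
    then have "f x = g x" if "x \<in> carrier H" for x
      using hom_eq_on_generate[OF assms(1,2) _ _ assms(5)] fg that gen
      by (auto simp: homomorphisms_def)
    then show "f = g"
      using fg by (auto simp: homomorphisms_def intro: extensionalityI)
  qed
qed

section \<open>Threads, slenderness and stable images\<close>

lemma carrier_inverse_limit_group:
  "x \<in> carrier (inverse_limit_group H p) \<longleftrightarrow>
     (\<forall>i. x i \<in> carrier (H i)) \<and> (\<forall>i j. i < j \<longrightarrow> p i j (x j) = x i)"
  by (auto simp: inverse_limit_group_def PiE_iff)

lemma mult_inverse_limit_group:
  "x \<otimes>\<^bsub>inverse_limit_group H p\<^esub> y = (\<lambda>i. x i \<otimes>\<^bsub>H i\<^esub> y i)"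
  by (simp add: inverse_limit_group_def restrict_def)

text \<open>Slenderness with respect to groups carried by one infinite type suffices for inverse
  sequences of countable groups on any type: these can be copied into the given type.\<close>

lemma inverse_limit_slender_countable:
  fixes H :: "nat \<Rightarrow> 'k monoid" and G :: "('g, 'm) monoid_scheme"
  assumes slender: "inverse_limit_slender TYPE('h::infinite) G"
    and H: "inverse_sequence_groups H p" and ml: "mittag_leffler H p"
    and count: "\<And>i. countable (carrier (H i))"
    and \<phi>: "\<phi> \<in> hom (inverse_limit_group H p) G"
  obtains i \<psi> where "\<psi> \<in> hom (H i) G"
    "\<And>x. x \<in> carrier (inverse_limit_group H p) \<Longrightarrow> \<phi> x = \<psi> (x i)"
proof -
  have "\<exists>f :: nat \<Rightarrow> 'h. inj f"
    using infinite_countable_subset[OF infinite_UNIV[where 'a = 'h]] by auto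
  then obtain f :: "nat \<Rightarrow> 'h" where f: "inj f" by blast
  \<comment> \<open>Enumerating the countable carrier and then applying \<open>f\<close> embeds it
    into \<open>'h\<close>. Along these bijections \<open>K\<close> and \<open>r\<close> are copies
    of \<open>H\<close> and \<open>p\<close>, and threads correspond coordinate by
    coordinate.\<close>
  define e where "e i = f \<circ> to_nat_on (carrier (H i))" for i
  define d where "d i = inv_into (carrier (H i)) (e i)" for i
  have inj: "inj_on (e i) (carrier (H i))" for i
    unfolding e_def by (rule comp_inj_on) (use f count in \<open>auto intro: inj_on_subset\<close>)
  define K where "K i = image_group (e i) (H i)" for i
  define r where "r i j = e i \<circ> p i j \<circ> d j" for i j
  have grp: "group (H i)" and p: "i < j \<Longrightarrow> p i j \<in> hom (H j) (H i)"
    and pp: "i < j \<Longrightarrow> j < k \<Longrightarrow> z \<in> carrier (H k) \<Longrightarrow> p i j (p j k z) = p i k z" for i j k z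
    using H by (auto simp: inverse_sequence_groups_def)
  have carK: "carrier (K i) = e i ` carrier (H i)" for i
    by (simp add: K_def image_group_carrier)
  have de: "d i (e i x) = x" if "x \<in> carrier (H i)" for i x
    using inj that by (simp add: d_def)
  have multK: "e i x \<otimes>\<^bsub>K i\<^esub> e i y = e i (x \<otimes>\<^bsub>H i\<^esub> y)" if "x \<in> carrier (H i)" "y \<in> carrier (H i)" for i x y
    using de that by (simp add: K_def image_group_def d_def)
  have closed: "x \<otimes>\<^bsub>H i\<^esub> y \<in> carrier (H i)" if "x \<in> carrier (H i)" "y \<in> carrier (H i)" for i x y
    using grp[of i] that by (simp add: group.is_monoid monoid.m_closed)
  have pcl: "p i j x \<in> carrier (H i)" if "i < j" "x \<in> carrier (H j)" for i j x
    using p that by (auto simp: hom_def)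
  have re: "r i j (e j x) = e i (p i j x)" if "x \<in> carrier (H j)" for i j x
    using that by (simp add: r_def de)
  have "inverse_sequence_groups K r"
    unfolding inverse_sequence_groups_def
  proof (intro conjI allI impI ballI)
    show "group (K i)" for i
      unfolding K_def by (rule group.inj_imp_image_group_is_group[OF grp inj])
    show "r i j \<in> hom (K j) (K i)" if "i < j" for i j
    proof (rule homI)
      fix x assume "x \<in> carrier (K j)"
      then show "r i j x \<in> carrier (K i)" using that by (auto simp: carK re pcl)
    next
      fix x y assume "x \<in> carrier (K j)" "y \<in> carrier (K j)"
      then show "r i j (x \<otimes>\<^bsub>K j\<^esub> y) = r i j x \<otimes>\<^bsub>K i\<^esub> r i j y"
        using that p[OF that] by (auto simp: carK re pcl multK closed hom_def)
    qed
    show "r i j (r j k x) = r i k x" if "i < j" "j < k" "x \<in> carrier (K k)" for i j k x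
      using that by (auto simp: carK re pcl pp)
  qed
  moreover have "mittag_leffler K r"
    unfolding mittag_leffler_def
  proof
    fix i
    from ml obtain j where "j > i" and j: "\<And>k. k \<ge> j \<Longrightarrow> p i k ` carrier (H k) = p i j ` carrier (H j)"
      unfolding mittag_leffler_def by metis
    have "r i k ` carrier (K k) = e i ` (p i k ` carrier (H k))" for k
      unfolding carK by (auto simp: image_image re)
    then show "\<exists>j>i. \<forall>k\<ge>j. r i k ` carrier (K k) = r i j ` carrier (K j)"
      using \<open>j > i\<close> j by metis
  qed
  moreover define \<Phi> where "\<Phi> y = \<phi> (\<lambda>i. d i (y i))" for y
  have lift: "\<exists>x \<in> carrier (inverse_limit_group H p). y = (\<lambda>i. e i (x i))"
    if "y \<in> carrier (inverse_limit_group K r)" for y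
  proof
    have y: "\<And>i. y i \<in> e i ` carrier (H i)" "\<And>i j. i < j \<Longrightarrow> r i j (y j) = y i"
      using that by (auto simp: carrier_inverse_limit_group carK)
    then have d: "d i (y i) \<in> carrier (H i)" "e i (d i (y i)) = y i" for i
      using de by (metis imageE)+
    then have "p i j (d j (y j)) = d i (y i)" if "i < j" for i j
      by (metis de pcl re that y(2))
    then show "(\<lambda>i. d i (y i)) \<in> carrier (inverse_limit_group H p)"
      using d by (simp add: carrier_inverse_limit_group)
    show "y = (\<lambda>i. e i (d i (y i)))" using d by simp
  qed
  have \<Phi>: "\<Phi> (\<lambda>i. e i (x i)) = \<phi> x" if "x \<in> carrier (inverse_limit_group H p)" for x
    using that by (simp add: \<Phi>_def de carrier_inverse_limit_group)
  have "\<Phi> \<in> hom (inverse_limit_group K r) G"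
  proof (rule homI)
    fix y assume "y \<in> carrier (inverse_limit_group K r)"
    then show "\<Phi> y \<in> carrier G" using lift[of y] \<Phi> \<phi> by (auto simp: hom_def)
  next
    fix y y' assume "y \<in> carrier (inverse_limit_group K r)" "y' \<in> carrier (inverse_limit_group K r)"
    then obtain x x' where x: "x \<in> carrier (inverse_limit_group H p)" "y = (\<lambda>i. e i (x i))"
      "x' \<in> carrier (inverse_limit_group H p)" "y' = (\<lambda>i. e i (x' i))"
      using lift by metis
    then have m: "y \<otimes>\<^bsub>inverse_limit_group K r\<^esub> y' = (\<lambda>i. e i ((x \<otimes>\<^bsub>inverse_limit_group H p\<^esub> x') i))"
      by (simp add: mult_inverse_limit_group multK carrier_inverse_limit_group)
    have "x \<otimes>\<^bsub>inverse_limit_group H p\<^esub> x' \<in> carrier (inverse_limit_group H p)"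
      using x(1,3) p by (auto simp: carrier_inverse_limit_group mult_inverse_limit_group closed hom_def)
    then show "\<Phi> (y \<otimes>\<^bsub>inverse_limit_group K r\<^esub> y') = \<Phi> y \<otimes>\<^bsub>G\<^esub> \<Phi> y'"
      unfolding m using x \<Phi> \<phi> by (auto simp: hom_def)
  qed
  ultimately obtain i \<psi> where \<psi>: "\<psi> \<in> hom (K i) G"
    "\<And>y. y \<in> carrier (inverse_limit_group K r) \<Longrightarrow> \<Phi> y = \<psi> (y i)"
    using slender unfolding inverse_limit_slender_def by metis
  show thesis
  proof
    show "\<psi> \<circ> e i \<in> hom (H i) G"
      using \<psi>(1) by (auto simp: hom_def carK multK[symmetric])
    fix x assume x: "x \<in> carrier (inverse_limit_group H p)"
    then have "(\<lambda>i. e i (x i)) \<in> carrier (inverse_limit_group K r)"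
      by (auto simp: carrier_inverse_limit_group carK re)
    then show "\<phi> x = (\<psi> \<circ> e i) (x i)"
      using \<psi>(2) \<Phi>[OF x] by fastforce
  qed
qed

text \<open>Assumption \<open>fg\<close> does double duty: the inclusions for all
  \<open>k \<ge> j\<close> make the images in \<open>H i\<close> stabilise, and the case
  \<open>k = j\<close> makes the stable image finitely generated. The stable images form a sequence
  with the same limit and surjective bonding maps. So every homomorphism on the limit comes from one
  of countably many groups, each with countably many homomorphisms to \<open>G\<close>.\<close>

lemma countable_homomorphisms_inverse_limit:
  fixes H :: "nat \<Rightarrow> 'k monoid" and G :: "('g, 'm) monoid_scheme"
  assumes "group G" "countable (carrier G)"
    and slender: "inverse_limit_slender TYPE('h::infinite) G"
    and H: "inverse_sequence_groups H p"
    and fg: "\<And>i. \<exists>j>i. \<forall>k\<ge>j. \<exists>S\<subseteq>carrier (H k). finite S \<and> p i j ` carrier (H j) \<subseteq> p i k ` generate (H k) S"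
  shows "countable (homomorphisms (inverse_limit_group H p) G)"
proof -
  have grp: "group (H i)" and p: "i < j \<Longrightarrow> p i j \<in> hom (H j) (H i)"
    and pp: "i < j \<Longrightarrow> j < k \<Longrightarrow> z \<in> carrier (H k) \<Longrightarrow> p i j (p j k z) = p i k z" for i j k z
    using H by (auto simp: inverse_sequence_groups_def)
  have ph: "group_hom (H j) (H i) (p i j)" if "i < j" for i j
    using grp p[OF that] by (simp add: group_hom_def group_hom_axioms_def)
  from fg obtain s where s: "\<And>i. s i > i" and gen: "\<And>i k. k \<ge> s i \<Longrightarrow>
      \<exists>S\<subseteq>carrier (H k). finite S \<and> p i (s i) ` carrier (H (s i)) \<subseteq> p i k ` generate (H k) S"
    by metis
  define M where "M i = p i (s i) ` carrier (H (s i))" for i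
  have sub: "subgroup (M i) (H i)" for i
    unfolding M_def using group_hom.img_is_subgroup[OF ph[OF s]] .
  \<comment> \<open>One inclusion holds because \<open>p i k\<close> factors through level
    \<open>s i\<close>, the other because generated subgroups stay inside
    \<open>H k\<close>.\<close>
  have stable: "p i k ` carrier (H k) = M i" if k: "k \<ge> s i" for i k
  proof
    show "p i k ` carrier (H k) \<subseteq> M i"
    proof (cases "k = s i")
      case False
      then have "s i < k" using k by simp
      moreover have "p (s i) k ` carrier (H k) \<subseteq> carrier (H (s i))"
        using p[OF \<open>s i < k\<close>] by (auto simp: hom_def)
      ultimately show ?thesis
        unfolding M_def using pp[OF s \<open>s i < k\<close>] by (auto simp flip: pp[OF s \<open>s i < k\<close>])
    qed (simp add: M_def)
    obtain S where "S \<subseteq> carrier (H k)" "M i \<subseteq> p i k ` generate (H k) S"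
      using gen[OF k] unfolding M_def by blast
    then show "M i \<subseteq> p i k ` carrier (H k)"
      using group.generate_incl[OF grp] by blast
  qed
  have MM: "p i l ` M l = M i" if "i < l" for i l
  proof -
    \<comment> \<open>Past both stabilisation indices, \<open>M i\<close> and \<open>M l\<close> are
      images of one group \<open>H k\<close>.\<close>
    define k where "k = max (s i) (s l)"
    have "l < k" using s[of l] by (simp add: k_def)
    have "p i l ` M l = p i l ` (p l k ` carrier (H k))"
      using stable[of l k] by (simp add: k_def)
    also have "\<dots> = p i k ` carrier (H k)"
      using pp[OF that \<open>l < k\<close>] by (auto simp: image_image)
    also have "\<dots> = M i"
      using stable[of i k] by (simp add: k_def)
    finally show ?thesis .
  qed
  define K where "K i = (H i)\<lparr>carrier := M i\<rparr>" for i
  have carK: "carrier (K i) = M i" for i by (simp add: K_def)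
  have subset: "M i \<subseteq> carrier (H i)" for i
    using sub subgroup.subset by blast
  have grpK: "group (K i)" for i
    unfolding K_def by (rule subgroup.subgroup_is_group[OF sub grp])
  have seqK: "inverse_sequence_groups K p"
    unfolding inverse_sequence_groups_def
  proof (intro conjI allI impI ballI)
    show "p i j \<in> hom (K j) (K i)" if "i < j" for i j
      using p[OF that] subset[of j] MM[OF that] by (auto simp: hom_def K_def subset_iff)
  qed (use grpK pp subset in \<open>auto simp: K_def subset_iff\<close>)
  \<comment> \<open>The bonding maps of \<open>K\<close> are onto, so every later index satisfies
    the condition.\<close>
  have mlK: "mittag_leffler K p"
    unfolding mittag_leffler_def carK using MM by (metis Suc_le_lessD lessI)
  have fgK: "\<exists>S\<subseteq>carrier (K i). finite S \<and> carrier (K i) = generate (K i) S" for i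
  proof -
    obtain S where S: "S \<subseteq> carrier (H (s i))" "finite S" "M i \<subseteq> p i (s i) ` generate (H (s i)) S"
      using gen[of i "s i"] unfolding M_def by auto
    have "p i (s i) ` generate (H (s i)) S \<subseteq> M i"
      unfolding M_def using group.generate_incl[OF grp S(1)] by blast
    then have "M i = generate (H i) (p i (s i) ` S)"
      using S group_hom.generate_img[OF ph[OF s] S(1)] by simp
    moreover have sub': "p i (s i) ` S \<subseteq> M i" using S unfolding M_def by blast
    ultimately have "M i = generate (K i) (p i (s i) ` S)"
      using group.generate_consistent[OF grp sub' sub] by (simp add: K_def)
    then show ?thesis using S sub' carK by (metis finite_imageI)
  qed
  have count: "countable (carrier (K i))" for i
    using fgK[of i] countable_generate[OF countable_finite] by metis
  have lim: "inverse_limit_group H p = inverse_limit_group K p"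
  proof -
    \<comment> \<open>Coordinate \<open>i\<close> of a thread is the image of its coordinate
      \<open>s i\<close>.\<close>
    have "x i \<in> M i" if "x \<in> carrier (inverse_limit_group H p)" for x i
      using that s[of i] unfolding M_def carrier_inverse_limit_group by (metis imageI)
    then have "x \<in> carrier (inverse_limit_group H p) \<longleftrightarrow> x \<in> carrier (inverse_limit_group K p)" for x
      using subset carK unfolding carrier_inverse_limit_group by blast
    then have "carrier (inverse_limit_group H p) = carrier (inverse_limit_group K p)"
      by blast
    then show ?thesis
      by (simp add: inverse_limit_group_def product_group_def K_def)
  qed
  have "homomorphisms (inverse_limit_group K p) G \<subseteq>
      (\<Union>i. (\<lambda>\<psi>. restrict (\<lambda>x. \<psi> (x i)) (carrier (inverse_limit_group K p))) ` homomorphisms (K i) G)"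
  proof
    fix \<phi> assume \<phi>: "\<phi> \<in> homomorphisms (inverse_limit_group K p) G"
    then obtain i \<psi> where \<psi>: "\<psi> \<in> hom (K i) G"
        "\<And>x. x \<in> carrier (inverse_limit_group K p) \<Longrightarrow> \<phi> x = \<psi> (x i)"
      using inverse_limit_slender_countable[OF slender seqK mlK count] unfolding homomorphisms_def by blast
    \<comment> \<open>\<open>\<psi>\<close> is arbitrary outside the carrier; its restriction is the
      representative that is counted.\<close>
    have "restrict \<psi> (carrier (K i)) \<in> homomorphisms (K i) G"
      using \<psi>(1) grpK[of i] by (auto simp: homomorphisms_def hom_def group.is_monoid monoid.m_closed)
    moreover have "\<phi> = restrict (\<lambda>x. restrict \<psi> (carrier (K i)) (x i)) (carrier (inverse_limit_group K p))"
      using \<phi> \<psi>(2) by (auto simp: homomorphisms_def carrier_inverse_limit_group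
        intro!: extensionalityI[of _ "carrier (inverse_limit_group K p)"])
    ultimately show "\<phi> \<in> (\<Union>i. (\<lambda>\<psi>. restrict (\<lambda>x. \<psi> (x i)) (carrier (inverse_limit_group K p))) ` homomorphisms (K i) G)"
      by blast
  qed
  moreover have "countable (homomorphisms (K i) G)" for i
    using fgK[of i] countable_homomorphisms_finitely_generated[OF grpK assms(1,2)] by metis
  ultimately show ?thesis
    unfolding lim by (meson countable_UN countable_image countable_subset countableI_type)
qed

section \<open>Fundamental groups\<close>

text \<open>The straight-line homotopy from \<open>\<phi>\<close> to \<open>\<psi>\<close> stays in
  the convex set \<open>{0..1}\<close> and keeps the ends; \<open>p\<close> carries it into
  \<open>S\<close>, which may lie in any topological space.\<close>

lemma homotopic_paths_compose_interval:
  fixes p :: "real \<Rightarrow> 'a::topological_space" and \<phi> \<psi> :: "real \<Rightarrow> real"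
  assumes "path p" "path_image p \<subseteq> S"
    and "path \<phi>" "path_image \<phi> \<subseteq> {0..1}" "path \<psi>" "path_image \<psi> \<subseteq> {0..1}"
    and "pathstart \<phi> = pathstart \<psi>" "pathfinish \<phi> = pathfinish \<psi>"
  shows "homotopic_paths S (p \<circ> \<phi>) (p \<circ> \<psi>)"
proof (rule homotopic_paths_continuous_image)
  show "homotopic_paths {0..1} \<phi> \<psi>"
  proof (rule homotopic_paths_linear)
    show "closed_segment (\<phi> t) (\<psi> t) \<subseteq> {0..1}" if "t \<in> {0..1}" for t
      using that assms(4,6) by (intro closed_segment_subset) (auto simp: path_image_def image_subset_iff)
  qed (use assms in auto)
qed (use assms(1,2) in \<open>auto simp: path_def path_image_def\<close>)

text \<open>These instances turn the law for joined subpaths into the unit law (parameters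
  \<open>0, 0, 1\<close>) and the inverse laws (\<open>0, 1, 0\<close> and
  \<open>1, 0, 1\<close>).\<close>

lemma linepath_compose_simps:
  fixes p :: "real \<Rightarrow> 'a::topological_space"
  shows "p \<circ> linepath 0 1 = p" "p \<circ> linepath 1 0 = reversepath p" "p \<circ> linepath u u = (\<lambda>_. p u)"
  by (auto simp: linepath_def reversepath_def fun_eq_iff algebra_simps)

lemma path_linepath_join_in_interval:
  fixes u v w :: real
  assumes "u \<in> {0..1}" "v \<in> {0..1}" "w \<in> {0..1}"
  shows "path (linepath u v +++ linepath v w)" "path_image (linepath u v +++ linepath v w) \<subseteq> {0..1}"
  using assms closed_segment_subset[OF assms(1,2)] closed_segment_subset[OF assms(2,3)]
  by (auto simp: path_image_join)

text \<open>The library has \<open>subpath\<close>, and the unit and inverse laws for \<open>homotopic_paths\<close>, only in normed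
  spaces; \<open>p \<circ> linepath u v\<close> is the subpath of \<open>p\<close> from \<open>u\<close> to \<open>v\<close>.\<close>

lemma homotopic_paths_join_subpaths:
  fixes p :: "real \<Rightarrow> 'a::topological_space"
  assumes "path p" "path_image p \<subseteq> S" "u \<in> {0..1}" "v \<in> {0..1}" "w \<in> {0..1}"
  shows "homotopic_paths S ((p \<circ> linepath u v) +++ (p \<circ> linepath v w)) (p \<circ> linepath u w)"
proof -
  have "homotopic_paths S (p \<circ> (linepath u v +++ linepath v w)) (p \<circ> linepath u w)"
    using path_linepath_join_in_interval[of u v w] closed_segment_subset[OF assms(3,5)] assms
    by (intro homotopic_paths_compose_interval) auto
  then show ?thesis
    by (simp add: path_compose_join)
qed

lemma homotopic_paths_const_join:
  fixes p :: "real \<Rightarrow> 'a::topological_space"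
  assumes "path p" "path_image p \<subseteq> S"
  shows "homotopic_paths S ((\<lambda>_. pathstart p) +++ p) p"
  using homotopic_paths_join_subpaths[OF assms, of 0 0 1]
  by (simp add: pathstart_def linepath_compose_simps)

lemma homotopic_paths_join_reversepath:
  fixes p :: "real \<Rightarrow> 'a::topological_space"
  assumes "path p" "path_image p \<subseteq> S"
  shows "homotopic_paths S (p +++ reversepath p) (\<lambda>_. pathstart p)"
    "homotopic_paths S (reversepath p +++ p) (\<lambda>_. pathfinish p)"
  using homotopic_paths_join_subpaths[OF assms, of 0 1 0] homotopic_paths_join_subpaths[OF assms, of 1 0 1]
  by (simp_all add: pathstart_def pathfinish_def linepath_compose_simps)

section \<open>Loop representatives, the group laws and induced maps\<close>

definition loop_class :: "'a::topological_space set \<Rightarrow> (real \<Rightarrow> 'a) \<Rightarrow> (real \<Rightarrow> 'a) set" where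
  "loop_class S g = {r. homotopic_paths S g r}"

lemma loop_class_eq_iff:
  assumes "g \<in> loops_at S x"
  shows "loop_class S g = loop_class S h \<longleftrightarrow> homotopic_paths S g h"
proof
  assume "loop_class S g = loop_class S h"
  moreover have "g \<in> loop_class S g"
    using assms by (simp add: loop_class_def loops_at_def)
  ultimately have "g \<in> loop_class S h" by simp
  then show "homotopic_paths S g h"
    using homotopic_paths_sym by (auto simp: loop_class_def)
next
  assume "homotopic_paths S g h"
  then show "loop_class S g = loop_class S h"
    unfolding loop_class_def by (blast intro: homotopic_paths_sym homotopic_paths_trans)
qed

lemma carrier_fundamental_group:
  "carrier (fundamental_group S x) = loop_class S ` loops_at S x"
  by (auto simp: fundamental_group_def quotient_def loop_class_def)

lemma one_fundamental_group: "\<one>\<^bsub>fundamental_group S x\<^esub> = loop_class S (\<lambda>_. x)"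
  by (simp add: fundamental_group_def loop_class_def)

lemma mult_fundamental_group:
  assumes "g \<in> loops_at S x" "h \<in> loops_at S x"
  shows "loop_class S g \<otimes>\<^bsub>fundamental_group S x\<^esub> loop_class S h = loop_class S (g +++ h)"
proof -
  have "(\<exists>g'. homotopic_paths S g g' \<and> (\<exists>h'. homotopic_paths S h h' \<and> homotopic_paths S (g' +++ h') r))
      \<longleftrightarrow> homotopic_paths S (g +++ h) r" for r
  proof
    assume "\<exists>g'. homotopic_paths S g g' \<and> (\<exists>h'. homotopic_paths S h h' \<and> homotopic_paths S (g' +++ h') r)"
    then obtain g' h' where gh: "homotopic_paths S g g'" "homotopic_paths S h h'" "homotopic_paths S (g' +++ h') r"
      by blast
    have "pathfinish g = pathstart h" using assms by (simp add: loops_at_def)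
    then show "homotopic_paths S (g +++ h) r"
      using homotopic_paths_join[OF gh(1,2)] gh(3) homotopic_paths_trans by blast
  next
    assume "homotopic_paths S (g +++ h) r"
    moreover have "homotopic_paths S g g" "homotopic_paths S h h" using assms by (auto simp: loops_at_def)
    ultimately show "\<exists>g'. homotopic_paths S g g' \<and> (\<exists>h'. homotopic_paths S h h' \<and> homotopic_paths S (g' +++ h') r)"
      by blast
  qed
  then show ?thesis
    by (auto simp: fundamental_group_def loop_class_def)
qed

lemma loops_at_join: "g \<in> loops_at S x \<Longrightarrow> h \<in> loops_at S x \<Longrightarrow> g +++ h \<in> loops_at S x"
  by (auto simp: loops_at_def path_image_join)

lemma loops_at_reversepath: "g \<in> loops_at S x \<Longrightarrow> reversepath g \<in> loops_at S x"
  by (auto simp: loops_at_def)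

lemma loops_at_const: "x \<in> S \<Longrightarrow> (\<lambda>_. x) \<in> loops_at S x"
  by (auto simp: loops_at_def path_def path_image_def pathstart_def pathfinish_def)

lemma group_fundamental_group:
  fixes S :: "'a::topological_space set"
  assumes "x \<in> S"
  shows "group (fundamental_group S x)"
proof (rule groupI)
  note car = carrier_fundamental_group and mult = mult_fundamental_group
  let ?G = "fundamental_group S x"
  show "\<one>\<^bsub>?G\<^esub> \<in> carrier ?G"
    using assms by (simp add: car one_fundamental_group loops_at_const)
  fix A assume "A \<in> carrier ?G"
  then obtain f where A: "A = loop_class S f" and f: "f \<in> loops_at S x" by (auto simp: car)
  have f': "path f" "path_image f \<subseteq> S" "pathstart f = x" "pathfinish f = x"
    using f by (auto simp: loops_at_def)
  have "homotopic_paths S ((\<lambda>_. x) +++ f) f"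
    using homotopic_paths_const_join[of f S] f' by simp
  then show "\<one>\<^bsub>?G\<^esub> \<otimes>\<^bsub>?G\<^esub> A = A"
    using f assms loops_at_const[OF assms] loop_class_eq_iff[OF loops_at_join]
    by (metis A mult one_fundamental_group)
  have "homotopic_paths S (reversepath f +++ f) (\<lambda>_. x)"
    using homotopic_paths_join_reversepath(2)[of f S] f' by simp
  then have "loop_class S (reversepath f) \<otimes>\<^bsub>?G\<^esub> A = \<one>\<^bsub>?G\<^esub>"
    using loop_class_eq_iff[OF loops_at_join[OF loops_at_reversepath[OF f] f]]
    by (simp add: A mult[OF loops_at_reversepath[OF f] f] one_fundamental_group)
  then show "\<exists>B\<in>carrier ?G. B \<otimes>\<^bsub>?G\<^esub> A = \<one>\<^bsub>?G\<^esub>"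
    using loops_at_reversepath[OF f] by (auto simp: car)
  fix B assume "B \<in> carrier ?G"
  then obtain g where B: "B = loop_class S g" and g: "g \<in> loops_at S x" by (auto simp: car)
  show "A \<otimes>\<^bsub>?G\<^esub> B \<in> carrier ?G"
    unfolding A B mult[OF f g] car using loops_at_join[OF f g] by blast
  fix C assume "C \<in> carrier ?G"
  then obtain h where C: "C = loop_class S h" and h: "h \<in> loops_at S x" by (auto simp: car)
  have "homotopic_paths S (f +++ (g +++ h)) ((f +++ g) +++ h)"
    using f g h by (intro homotopic_paths_assoc) (auto simp: loops_at_def)
  then have "homotopic_paths S ((f +++ g) +++ h) (f +++ (g +++ h))"
    by (rule homotopic_paths_sym)
  then show "A \<otimes>\<^bsub>?G\<^esub> B \<otimes>\<^bsub>?G\<^esub> C = A \<otimes>\<^bsub>?G\<^esub> (B \<otimes>\<^bsub>?G\<^esub> C)"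
    unfolding A B C mult[OF f g] mult[OF g h] mult[OF loops_at_join[OF f g] h] mult[OF f loops_at_join[OF g h]]
    using loop_class_eq_iff[OF loops_at_join[OF loops_at_join[OF f g] h]] by blast
qed

lemma loops_at_compose:
  assumes "continuous_on S f" "f ` S \<subseteq> T" "g \<in> loops_at S x"
  shows "f \<circ> g \<in> loops_at T (f x)"
  using assms continuous_on_subset[OF assms(1)]
  by (auto simp: loops_at_def path_image_compose pathstart_compose pathfinish_compose intro!: path_continuous_image)

lemma induced_map_loop_class:
  assumes "continuous_on S f" "f ` S \<subseteq> T" "g \<in> loops_at S x"
  shows "induced_map T f (loop_class S g) = loop_class T (f \<circ> g)"
proof -
  have "homotopic_paths T (f \<circ> g) (f \<circ> g')" if "homotopic_paths S g g'" for g'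
    using homotopic_paths_continuous_image[OF that assms(1)] assms(2) by auto
  moreover have "homotopic_paths S g g" using assms(3) by (auto simp: loops_at_def)
  ultimately show ?thesis
    unfolding induced_map_def loop_class_def
    by (blast intro: homotopic_paths_trans)
qed

lemma induced_map_hom:
  assumes "continuous_on S f" "f ` S \<subseteq> T"
  shows "induced_map T f \<in> hom (fundamental_group S x) (fundamental_group T (f x))"
proof (rule homI)
  fix A assume "A \<in> carrier (fundamental_group S x)"
  then show "induced_map T f A \<in> carrier (fundamental_group T (f x))"
    using loops_at_compose[OF assms] by (auto simp: carrier_fundamental_group induced_map_loop_class[OF assms])
next
  fix A B assume "A \<in> carrier (fundamental_group S x)" "B \<in> carrier (fundamental_group S x)"
  then obtain g h where gh: "A = loop_class S g" "g \<in> loops_at S x" "B = loop_class S h" "h \<in> loops_at S x"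
    by (auto simp: carrier_fundamental_group)
  show "induced_map T f (A \<otimes>\<^bsub>fundamental_group S x\<^esub> B)
      = induced_map T f A \<otimes>\<^bsub>fundamental_group T (f x)\<^esub> induced_map T f B"
    unfolding gh(1,3) mult_fundamental_group[OF gh(2,4)] induced_map_loop_class[OF assms gh(2)]
      induced_map_loop_class[OF assms gh(4)] induced_map_loop_class[OF assms loops_at_join[OF gh(2,4)]]
      path_compose_join
    by (rule mult_fundamental_group[symmetric, OF loops_at_compose[OF assms gh(2)] loops_at_compose[OF assms gh(4)]])
qed

lemma inverse_sequence_fundamental_groups:
  assumes "inverse_sequence_spaces P p" "\<And>i. a i \<in> P i" "\<And>i j. i < j \<Longrightarrow> p i j (a j) = a i"
  shows "inverse_sequence_groups (\<lambda>i. fundamental_group (P i) (a i)) (\<lambda>i j. induced_map (P i) (p i j))"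
proof -
  have p: "\<And>i j. i < j \<Longrightarrow> continuous_on (P j) (p i j)" "\<And>i j. i < j \<Longrightarrow> p i j ` P j \<subseteq> P i"
    and pp: "\<And>i j k x. i < j \<Longrightarrow> j < k \<Longrightarrow> x \<in> P k \<Longrightarrow> p i j (p j k x) = p i k x"
    using assms(1) by (auto simp: inverse_sequence_spaces_def)
  show ?thesis
    unfolding inverse_sequence_groups_def
  proof (intro conjI allI impI ballI)
    show "group (fundamental_group (P i) (a i))" for i
      using group_fundamental_group assms(2) .
    show "induced_map (P i) (p i j) \<in> hom (fundamental_group (P j) (a j)) (fundamental_group (P i) (a i))"
      if "i < j" for i j
      using induced_map_hom[OF p[OF that], of "a j"] assms(3)[OF that] by simp
    fix i j k :: nat and A
    assume ij: "i < j" and jk: "j < k" and "A \<in> carrier (fundamental_group (P k) (a k))"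
    then obtain g where g: "g \<in> loops_at (P k) (a k)" and A: "A = loop_class (P k) g"
      by (auto simp: carrier_fundamental_group)
    have ik: "i < k" using ij jk by simp
    have "p j k \<circ> g \<in> loops_at (P j) (p j k (a k))" by (rule loops_at_compose[OF p[OF jk] g])
    then have "induced_map (P i) (p i j) (induced_map (P j) (p j k) A) = loop_class (P i) (p i j \<circ> (p j k \<circ> g))"
      unfolding A induced_map_loop_class[OF p[OF jk] g] by (rule induced_map_loop_class[OF p[OF ij]])
    also have "\<dots> = loop_class (P i) (p i k \<circ> g)"
    proof -
      have loop: "p i k \<circ> g \<in> loops_at (P i) (p i k (a k))" by (rule loops_at_compose[OF p[OF ik] g])
      \<comment> \<open>Compatibility of the bonding maps is known on \<open>P k\<close> only, and
        \<open>g\<close> is unconstrained outside \<open>{0..1}\<close>. So the two loops need not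
        be equal as functions; agreement on \<open>{0..1}\<close> makes them homotopic.\<close>
      have "p i k (g t) = p i j (p j k (g t))" if "t \<in> {0..1}" for t
        using pp[OF ij jk] g that by (auto simp: loops_at_def path_image_def image_subset_iff)
      then have "homotopic_paths (P i) (p i k \<circ> g) (p i j \<circ> (p j k \<circ> g))"
        using loop by (intro homotopic_paths_eq) (auto simp: loops_at_def)
      from iffD2[OF loop_class_eq_iff[OF loop] this] show ?thesis by (rule sym)
    qed
    also have "\<dots> = induced_map (P i) (p i k) A"
      unfolding A induced_map_loop_class[OF p[OF ik] g] ..
    finally show "induced_map (P i) (p i j) (induced_map (P j) (p j k) A) = induced_map (P i) (p i k) A" .
  qed
qed

section \<open>Cutting a loop into pieces and closing these up\<close>

lemma homotopic_paths_cancel_middle: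
  fixes f g h :: "real \<Rightarrow> 'a::topological_space"
  assumes "path f" "path_image f \<subseteq> S" "path g" "path_image g \<subseteq> S" "path h" "path_image h \<subseteq> S"
    and "pathfinish f = pathfinish g" "pathfinish g = pathstart h"
  shows "homotopic_paths S ((f +++ reversepath g) +++ (g +++ h)) (f +++ h)"
proof -
  have "homotopic_paths S ((f +++ reversepath g) +++ (g +++ h)) (f +++ (reversepath g +++ (g +++ h)))"
    using assms by (intro homotopic_paths_sym[OF homotopic_paths_assoc]) (auto simp: path_image_join)
  also have "homotopic_paths S \<dots> (f +++ ((reversepath g +++ g) +++ h))"
    using assms by (intro homotopic_paths_join homotopic_paths_assoc) (auto simp: path_image_join)
  also have "homotopic_paths S \<dots> (f +++ ((\<lambda>_. pathfinish g) +++ h))"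
    using assms by (intro homotopic_paths_join homotopic_paths_join_reversepath) (auto simp: path_image_join)
  also have "homotopic_paths S \<dots> (f +++ h)"
  proof (rule homotopic_paths_join)
    show "homotopic_paths S ((\<lambda>_. pathfinish g) +++ h) h"
      using homotopic_paths_const_join[of h S] assms by simp
    show "pathfinish f = pathstart ((\<lambda>_. pathfinish g) +++ h)"
      using assms by (simp add: pathstart_def joinpaths_def)
  qed (use assms in simp)
  finally show ?thesis .
qed

text \<open>The domain \<open>{0..real n}\<close> gives each piece a unit interval, so appending one
  never reparametrises the earlier pieces.\<close>

lemma concatenate_paths:
  fixes s :: "nat \<Rightarrow> real \<Rightarrow> 'a::topological_space"
  assumes "0 < n" "\<And>m. m < n \<Longrightarrow> path (s m)"
    and "\<And>m. Suc m < n \<Longrightarrow> pathfinish (s m) = pathstart (s (Suc m))"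
  shows "\<exists>f. continuous_on {0..real n} f \<and> (\<forall>m<n. \<forall>t\<in>{0..1}. f (real m + t) = s m t)"
  using assms
proof (induction n rule: nat_induct_non_zero)
  case 1
  then show ?case by (intro exI[of _ "s 0"]) (auto simp: path_def)
next
  case (Suc n)
  then obtain f where f: "continuous_on {0..real n} f" "\<And>m t. m < n \<Longrightarrow> t \<in> {0..1} \<Longrightarrow> f (real m + t) = s m t"
    by force
  obtain k where k: "n = Suc k" using Suc(1) by (cases n) auto
  have agree: "f (real n) = s n 0"
    using f(2)[of k 1] Suc(4)[of k] k by (simp add: pathfinish_def pathstart_def add.commute)
  let ?g = "\<lambda>x. if x \<le> real n then f x else s n (x - real n)"
  have "continuous_on ({0..real n} \<union> {real n..real (Suc n)}) ?g"
  proof (rule continuous_on_cases)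
    have "continuous_on {0..1} (s n)" using Suc(3)[of n] by (simp add: path_def)
    then show "continuous_on {real n..real (Suc n)} (\<lambda>x. s n (x - real n))"
      by (rule continuous_on_compose2) (auto intro!: continuous_intros)
  qed (use f agree in auto)
  moreover have "{0..real n} \<union> {real n..real (Suc n)} = {0..real (Suc n)}" by auto
  moreover have "?g (real m + t) = s m t" if "m < Suc n" "t \<in> {0..1}" for m t
  proof (cases "m = n")
    case True
    then show ?thesis using that agree by (cases "t = 0") auto
  next
    case False
    then have "m < n" using that by simp
    moreover from this have "real m + t \<le> real n" using that(2) by auto
    ultimately show ?thesis using f(2) that by simp
  qed
  ultimately show ?case by (intro exI[of _ ?g]) auto
qed

text \<open>A telescoping product. The tails \<open>t m\<close> lead from the base point to the
  division points \<open>f (u m)\<close>; each piece is closed up by its two tails, and in the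
  product each inner tail meets its own reverse and cancels. The first and last tails are constant,
  so the whole product is \<open>f\<close> up to homotopy.\<close>

lemma loop_class_in_generate:
  fixes s t :: "nat \<Rightarrow> real \<Rightarrow> 'a::topological_space"
  assumes f: "f \<in> loops_at S x"
    and u: "u 0 = 0" "u n = 1" "\<And>m. u m \<in> {0..1}"
    and s: "\<And>m r. m < n \<Longrightarrow> r \<in> {0..1} \<Longrightarrow> f (linepath (u m) (u (Suc m)) r) = s m r"
    and t: "\<And>m. m \<le> n \<Longrightarrow> path (t m)" "\<And>m. m \<le> n \<Longrightarrow> path_image (t m) \<subseteq> S"
      "\<And>m. m \<le> n \<Longrightarrow> pathstart (t m) = x" "\<And>m. m \<le> n \<Longrightarrow> pathfinish (t m) = f (u m)"
      "t 0 = (\<lambda>_. x)" "t n = (\<lambda>_. x)"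
  shows "loop_class S f \<in> generate (fundamental_group S x)
    ((\<lambda>m. loop_class S (t m +++ (s m +++ reversepath (t (Suc m))))) ` {..<n})" (is "_ \<in> generate ?G ?A")
proof -
  have f': "path f" "path_image f \<subseteq> S" "f 0 = x" "f 1 = x"
    using f by (auto simp: loops_at_def pathstart_def pathfinish_def)
  have fS: "f r \<in> S" if "r \<in> {0..1}" for r using f'(2) that by (auto simp: path_image_def)
  have xS: "x \<in> S" using fS[of 0] f' by simp
  define sub where "sub a b = f \<circ> linepath a b" for a b
  have sub: "path (sub a b)" "path_image (sub a b) \<subseteq> S" if "a \<in> {0..1}" "b \<in> {0..1}" for a b
  proof -
    have seg: "path_image (linepath a b) \<subseteq> {0..1}" using closed_segment_subset[OF that] by simp
    then show "path (sub a b)"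
      unfolding sub_def using f' by (intro path_continuous_image) (auto simp: path_def intro: continuous_on_subset)
    show "path_image (sub a b) \<subseteq> S"
      unfolding sub_def path_image_compose using seg fS by blast
  qed
  have ends: "pathstart (sub a b) = f a" "pathfinish (sub a b) = f b" for a b
    by (simp_all add: sub_def pathstart_compose pathfinish_compose)
  \<comment> \<open>The induction follows the part of \<open>f\<close> up to time
    \<open>u m\<close>, brought back to \<open>x\<close> along \<open>t m\<close>.\<close>
  have "loop_class S (sub 0 (u m) +++ reversepath (t m)) \<in> generate ?G ?A" if "m \<le> n" for m
    using that
  proof (induction m)
    case 0
    have "sub 0 (u 0) +++ reversepath (t 0) = (\<lambda>_. x)"
      using f' u t by (simp add: sub_def linepath_compose_simps reversepath_def joinpaths_def)
    then show ?case
      using generate.one[of ?G ?A] by (simp add: one_fundamental_group)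
  next
    case (Suc m)
    let ?L = "sub 0 (u m) +++ reversepath (t m)"
    let ?E = "t m +++ (s m +++ reversepath (t (Suc m)))"
    \<comment> \<open>\<open>s m\<close> agrees with the subpath of \<open>f\<close> on
      \<open>{0..1}\<close> only, so \<open>?E'\<close> replaces \<open>?E\<close> up to
      homotopy.\<close>
    let ?E' = "t m +++ (sub (u m) (u (Suc m)) +++ reversepath (t (Suc m)))"
    have m: "m < n" "m \<le> n" using Suc by auto
    note facts = f' u sub ends t(1-4)[OF \<open>m \<le> n\<close>] t(1-4)[OF \<open>Suc m \<le> n\<close>]
    have seg: "homotopic_paths S (sub (u m) (u (Suc m))) (s m)"
      using s[OF m(1)] facts by (intro homotopic_paths_eq) (auto simp: sub_def)
    have L: "?L \<in> loops_at S x" using facts by (auto simp: loops_at_def path_image_join)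
    have E': "?E' \<in> loops_at S x" using facts by (auto simp: loops_at_def path_image_join)
    have EE: "homotopic_paths S ?E' ?E"
      using facts seg by (intro homotopic_paths_join) auto
    then have E: "loop_class S ?E = loop_class S ?E'"
      using loop_class_eq_iff[OF E'] by metis
    have "homotopic_paths S (?L +++ ?E') (sub 0 (u m) +++ (sub (u m) (u (Suc m)) +++ reversepath (t (Suc m))))"
      using facts by (intro homotopic_paths_cancel_middle) (auto simp: path_image_join)
    also have "homotopic_paths S \<dots> ((sub 0 (u m) +++ sub (u m) (u (Suc m))) +++ reversepath (t (Suc m)))"
      using facts by (intro homotopic_paths_assoc) (auto simp: path_image_join)
    also have "homotopic_paths S \<dots> (sub 0 (u (Suc m)) +++ reversepath (t (Suc m)))"
      using facts homotopic_paths_join_subpaths[OF f'(1,2), of 0 "u m" "u (Suc m)"]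
      by (intro homotopic_paths_join) (auto simp: sub_def)
    finally have "loop_class S (sub 0 (u (Suc m)) +++ reversepath (t (Suc m))) = loop_class S (?L +++ ?E')"
      using loop_class_eq_iff[OF loops_at_join[OF L E']] by metis
    also have "\<dots> = loop_class S ?L \<otimes>\<^bsub>?G\<^esub> loop_class S ?E"
      unfolding E by (rule mult_fundamental_group[OF L E', symmetric])
    also have "\<dots> \<in> generate ?G ?A"
      by (rule generate.eng[OF Suc.IH[OF m(2)] generate.incl]) (use m(1) in blast)
    finally show ?case .
  qed
  from this[of n] have "loop_class S (sub 0 1 +++ reversepath (t n)) \<in> generate ?G ?A"
    using u by simp
  moreover have "homotopic_paths S (sub 0 1 +++ reversepath (t n)) f"
  proof -
    have "reversepath (t n) = sub 1 1" "sub 0 1 = f"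
      using t(6) f' by (simp_all add: sub_def linepath_compose_simps reversepath_def)
    then show ?thesis
      using homotopic_paths_join_subpaths[OF f'(1,2), of 0 1 1] by (simp add: sub_def)
  qed
  then have "loop_class S (sub 0 1 +++ reversepath (t n)) = loop_class S f"
    using loop_class_eq_iff[OF f] homotopic_paths_sym by metis
  ultimately show ?thesis by simp
qed

lemma interval_cell:
  fixes r :: real
  assumes "0 < n" "r \<in> {0..1}"
  obtains m a where "m < n" "a \<in> {0..1}" "r = (real m + a) / real n"
proof (cases "r = 1")
  \<comment> \<open>Rounding down, as in the other case, would give \<open>m = n\<close> here; the
    point is the right end of the last cell.\<close>
  case True
  then show thesis
    using assms(1) by (intro that[of "n - 1" 1]) (auto simp: of_nat_diff)
next
  case False
  define m where "m = nat \<lfloor>real n * r\<rfloor>"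
  have "0 \<le> real n * r" "real n * r < real n" using assms False by auto
  then have m: "real m \<le> real n * r" "real n * r < real m + 1" "m < n"
    unfolding m_def by linarith+
  then show thesis
    using assms(1) by (intro that[of m "real n * r - real m"]) auto
qed

text \<open>The pointwise formula for \<open>f\<close> on the cells is kept beside the membership:
  it later allows \<open>f\<close> to be compared with another loop cut at the same times.\<close>

lemma concatenated_loop:
  fixes s t :: "nat \<Rightarrow> real \<Rightarrow> 'a::topological_space"
  assumes "0 < n"
    and s: "\<And>m. m < n \<Longrightarrow> path (s m)" "\<And>m. m < n \<Longrightarrow> path_image (s m) \<subseteq> S"
      "\<And>m. m < n \<Longrightarrow> pathstart (s m) = v m" "\<And>m. m < n \<Longrightarrow> pathfinish (s m) = v (Suc m)"
    and t: "\<And>m. m \<le> n \<Longrightarrow> path (t m)" "\<And>m. m \<le> n \<Longrightarrow> path_image (t m) \<subseteq> S"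
      "\<And>m. m \<le> n \<Longrightarrow> pathstart (t m) = x" "\<And>m. m \<le> n \<Longrightarrow> pathfinish (t m) = v m"
      "t 0 = (\<lambda>_. x)" "t n = (\<lambda>_. x)"
  obtains f where "f \<in> loops_at S x"
    "\<And>m r. m < n \<Longrightarrow> r \<in> {0..1} \<Longrightarrow> f ((real m + r) / real n) = s m r"
    "loop_class S f \<in> generate (fundamental_group S x)
      ((\<lambda>m. loop_class S (t m +++ (s m +++ reversepath (t (Suc m))))) ` {..<n})"
proof -
  obtain g where g: "continuous_on {0..real n} g" "\<And>m r. m < n \<Longrightarrow> r \<in> {0..1} \<Longrightarrow> g (real m + r) = s m r"
    using concatenate_paths[of n s] assms by auto
  define f where "f r = g (real n * r)" for r
  have v: "v 0 = x" "v n = x"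
    using t(4)[of 0] t(4)[of n] t(5,6) by (simp_all add: pathfinish_def)
  have fs: "f ((real m + r) / real n) = s m r" if "m < n" "r \<in> {0..1}" for m r
    using g(2)[OF that] \<open>0 < n\<close> by (simp add: f_def)
  have "f \<in> loops_at S x"
    unfolding loops_at_def
  proof (intro CollectI conjI)
    show "path f"
      unfolding path_def f_def using g(1)
      by (rule continuous_on_compose2) (use \<open>0 < n\<close> in \<open>auto intro!: continuous_intros simp: mult_left_le\<close>)
    show "path_image f \<subseteq> S"
    proof
      fix y assume "y \<in> path_image f"
      then obtain r where "r \<in> {0..1}" "y = f r" by (auto simp: path_image_def)
      obtain m a where ma: "m < n" "a \<in> {0..1}" "r = (real m + a) / real n"
        by (rule interval_cell[OF \<open>0 < n\<close> \<open>r \<in> {0..1}\<close>])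
      then have "y = s m a" using fs \<open>y = f r\<close> by simp
      then show "y \<in> S" using s(2)[OF ma(1)] ma(2) by (auto simp: path_image_def)
    qed
    show "pathstart f = x"
      using fs[of 0 0] s(3)[of 0] \<open>0 < n\<close> v by (simp add: pathstart_def)
    show "pathfinish f = x"
      using fs[of "n - 1" 1] s(4)[of "n - 1"] \<open>0 < n\<close> v by (simp add: pathfinish_def of_nat_diff)
  qed
  \<comment> \<open>The value 1 past \<open>n\<close> secures \<open>u m \<in> {0..1}\<close> for
    every \<open>m\<close>.\<close>
  moreover define u where "u m = (if m \<le> n then real m / real n else 1)" for m
  have "loop_class S f \<in> generate (fundamental_group S x)
      ((\<lambda>m. loop_class S (t m +++ (s m +++ reversepath (t (Suc m))))) ` {..<n})"
  proof (rule loop_class_in_generate[OF \<open>f \<in> loops_at S x\<close>, where u = u])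
    show "u 0 = 0" "u n = 1" "u m \<in> {0..1}" for m
      using \<open>0 < n\<close> by (auto simp: u_def)
    show "f (linepath (u m) (u (Suc m)) r) = s m r" if "m < n" "r \<in> {0..1}" for m r
    proof -
      have "linepath (u m) (u (Suc m)) r = (real m + r) / real n"
        using that \<open>0 < n\<close> by (simp add: u_def linepath_def field_simps)
      then show ?thesis using fs[OF that] by simp
    qed
    show "pathfinish (t m) = f (u m)" if "m \<le> n" for m
    proof (cases "m = n")
      case True
      then show ?thesis
        using t(6) \<open>0 < n\<close> \<open>f \<in> loops_at S x\<close> by (simp add: u_def loops_at_def pathfinish_def)
    next
      case False
      then have "m < n" using that by simp
      then show ?thesis using fs[of m 0] s(3)[of m] t(4)[OF that] by (simp add: u_def pathstart_def)
    qed
  qed (use t in auto)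
  ultimately show thesis using fs that by blast
qed

section \<open>Finite polyhedra\<close>

text \<open>Allowing any simplex that contains the support, in place of the support itself, displays
  the realization as a union of closed cells. The reverse direction uses that \<open>K\<close>
  contains the nonempty faces of its simplices.\<close>

lemma geometric_realization_iff:
  assumes "finite_simplicial_complex K"
  shows "t \<in> geometric_realization K \<longleftrightarrow>
    (\<exists>s\<in>K. (\<forall>v. 0 \<le> t v) \<and> (\<forall>v. v \<notin> s \<longrightarrow> t v = 0) \<and> (\<Sum>v\<in>s. t v) = 1)"
proof
  assume "t \<in> geometric_realization K"
  then have "\<forall>v. 0 \<le> t v" "{v. t v \<noteq> 0} \<in> K" "(\<Sum>v | t v \<noteq> 0. t v) = 1"
    by (simp_all add: geometric_realization_def)
  then show "\<exists>s\<in>K. (\<forall>v. 0 \<le> t v) \<and> (\<forall>v. v \<notin> s \<longrightarrow> t v = 0) \<and> (\<Sum>v\<in>s. t v) = 1"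
    by (intro bexI[of _ "{v. t v \<noteq> 0}"] conjI) simp_all
next
  assume "\<exists>s\<in>K. (\<forall>v. 0 \<le> t v) \<and> (\<forall>v. v \<notin> s \<longrightarrow> t v = 0) \<and> (\<Sum>v\<in>s. t v) = 1"
  then obtain s where s: "s \<in> K" "\<And>v. 0 \<le> t v" "\<And>v. v \<notin> s \<Longrightarrow> t v = 0" "(\<Sum>v\<in>s. t v) = 1"
    by blast
  have fin: "finite s" using assms s(1) by (auto simp: finite_simplicial_complex_def)
  have sub: "{v. t v \<noteq> 0} \<subseteq> s" using s(3) by blast
  have "(\<Sum>v | t v \<noteq> 0. t v) = (\<Sum>v\<in>s. t v)"
    by (rule sum.mono_neutral_left[OF fin sub]) auto
  then have one: "(\<Sum>v | t v \<noteq> 0. t v) = 1" using s(4) by simp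
  have "\<exists>v\<in>s. t v \<noteq> 0"
    by (rule ccontr) (use s(4) sum.neutral[of s t] in simp)
  then have ne: "{v. t v \<noteq> 0} \<noteq> {}" by blast
  have "\<forall>r. r \<noteq> {} \<and> r \<subseteq> s \<longrightarrow> r \<in> K"
    using bspec[OF conjunct2[OF assms[unfolded finite_simplicial_complex_def]] s(1)] by (elim conjE)
  then have suppK: "{v. t v \<noteq> 0} \<in> K"
    by (rule allE[of _ "{v. t v \<noteq> 0}"]) (rule mp, assumption, intro conjI ne sub)
  show "t \<in> geometric_realization K"
    unfolding geometric_realization_def using s(2) suppK one by (intro CollectI conjI allI)
qed

text \<open>Each of the finitely many cells is a closed subset of a product of unit intervals, which
  is compact.\<close>

lemma compact_geometric_realization:
  assumes "finite_simplicial_complex K"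
  shows "compact (geometric_realization K)"
proof -
  define cell :: "nat set \<Rightarrow> (nat \<Rightarrow> real) set" where
    "cell s = {t. (\<forall>v. 0 \<le> t v) \<and> (\<forall>v. v \<notin> s \<longrightarrow> t v = 0) \<and> (\<Sum>v\<in>s. t v) = 1}" for s
  have "compact (cell s)" if "s \<in> K" for s
  proof -
    have fin: "finite s" using assms that by (auto simp: finite_simplicial_complex_def)
    have co: "continuous_on UNIV (\<lambda>t::nat \<Rightarrow> real. t v)" for v
      by simp
    have "cell s = (\<Inter>v. {t. 0 \<le> t v}) \<inter> (\<Inter>v\<in>-s. {t. t v = 0}) \<inter> {t. (\<Sum>v\<in>s. t v) = 1}"
      by (auto simp: cell_def)
    moreover have "closed \<dots>"
      by (intro closed_Int closed_INT ballI closed_Collect_le closed_Collect_eq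
          continuous_on_sum co continuous_on_const)
    ultimately have cl: "closed (cell s)" by simp
    have "compactin (product_topology (\<lambda>_::nat. euclidean) UNIV) (PiE UNIV (\<lambda>_. {0..1::real}))"
      by (simp add: compactin_PiE)
    then have "compact (PiE UNIV (\<lambda>_::nat. {0..1::real}))"
      by (simp add: euclidean_product_topology)
    moreover have "cell s \<subseteq> PiE UNIV (\<lambda>_. {0..1})"
    proof
      fix t assume t: "t \<in> cell s"
      have "t v \<le> 1" for v
      proof (cases "v \<in> s")
        case True
        then have "t v \<le> (\<Sum>v\<in>s. t v)"
          using t fin by (intro member_le_sum) (auto simp: cell_def)
        then show ?thesis using t by (simp add: cell_def)
      qed (use t in \<open>auto simp: cell_def\<close>)
      then show "t \<in> PiE UNIV (\<lambda>_. {0..1})" using t by (auto simp: cell_def)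
    qed
    ultimately show ?thesis
      using compact_Int_closed[OF _ cl] by (metis inf.absorb_iff2)
  qed
  moreover have "geometric_realization K = (\<Union>s\<in>K. cell s)"
    using geometric_realization_iff[OF assms] by (auto simp: cell_def)
  ultimately show ?thesis
    using assms by (auto simp: finite_simplicial_complex_def)
qed

section \<open>Segments, homotopies and local structure in barycentric coordinates\<close>

lemma segment_in_geometric_realization:
  assumes "finite_simplicial_complex K" "s \<in> K"
    and "t \<in> geometric_realization K" "u \<in> geometric_realization K"
    and "{v. t v \<noteq> 0} \<subseteq> s" "{v. u v \<noteq> 0} \<subseteq> s" "a \<in> {0..1}"
  shows "(\<lambda>v. (1 - a) * t v + a * u v) \<in> geometric_realization K"
proof -
  have fin: "finite s" using assms by (auto simp: finite_simplicial_complex_def)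
  have off: "t v = 0 \<and> u v = 0" if "v \<notin> s" for v
    using assms(5,6) that by blast
  have sum1: "(\<Sum>v\<in>s. r v) = 1" if "r \<in> geometric_realization K" "{v. r v \<noteq> 0} \<subseteq> s" for r
    using that sum.mono_neutral_left[OF fin that(2), of r] by (auto simp: geometric_realization_def)
  have "(\<Sum>v\<in>s. (1 - a) * t v + a * u v) = (1 - a) * (\<Sum>v\<in>s. t v) + a * (\<Sum>v\<in>s. u v)"
    by (simp add: sum.distrib sum_distrib_left)
  also have "\<dots> = 1" using sum1 assms by simp
  finally have "(\<Sum>v\<in>s. (1 - a) * t v + a * u v) = 1" .
  moreover have "0 \<le> t v" "0 \<le> u v" for v using assms by (auto simp: geometric_realization_def)
  ultimately show ?thesis
    unfolding geometric_realization_iff[OF assms(1)]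
    using assms(2,7) off by (intro bexI[of _ s]) auto
qed

text \<open>At each time the segment from \<open>f x\<close> to \<open>g x\<close> lies in the
  common simplex, so the straight-line homotopy stays in the complex. Its continuity is checked
  coordinatewise.\<close>

lemma homotopic_paths_common_simplex:
  assumes K: "finite_simplicial_complex K"
    and f: "path f" "path_image f \<subseteq> geometric_realization K"
    and g: "path g" "path_image g \<subseteq> geometric_realization K"
    and ends: "pathstart f = pathstart g" "pathfinish f = pathfinish g"
    and close: "\<And>x. x \<in> {0..1} \<Longrightarrow> \<exists>s\<in>K. {v. f x v \<noteq> 0} \<subseteq> s \<and> {v. g x v \<noteq> 0} \<subseteq> s"
  shows "homotopic_paths (geometric_realization K) f g"
proof -
  let ?h = "\<lambda>(a, x). \<lambda>v. (1 - a) * f x v + a * g x v"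
  have coord: "continuous_on ({0..1} \<times> {0..1}) (\<lambda>z. p (snd z) v)" if "path p"
    for p :: "real \<Rightarrow> nat \<Rightarrow> real" and v
  proof -
    have "continuous_on {0..1} (\<lambda>x. p x v)"
      using that unfolding path_def by (rule continuous_on_product_then_coordinatewise)
    then show ?thesis
      by (rule continuous_on_compose2[OF _ continuous_on_snd[OF continuous_on_id]]) auto
  qed
  have "continuous_on ({0..1} \<times> {0..1}) ?h"
    unfolding case_prod_unfold
    by (rule continuous_on_coordinatewise_then_product, intro continuous_on_add continuous_on_mult
        continuous_on_diff continuous_on_const continuous_on_fst[OF continuous_on_id] coord[OF f(1)] coord[OF g(1)])
  moreover have "?h \<in> {0..1} \<times> {0..1} \<rightarrow> geometric_realization K"
  proof
    fix z :: "real \<times> real" assume z: "z \<in> {0..1} \<times> {0..1}"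
    then obtain s where "s \<in> K" "{v. f (snd z) v \<noteq> 0} \<subseteq> s" "{v. g (snd z) v \<noteq> 0} \<subseteq> s"
      using close[of "snd z"] by auto
    then show "?h z \<in> geometric_realization K"
      unfolding case_prod_unfold
      using z f g by (intro segment_in_geometric_realization[OF K]) (auto simp: path_image_def)
  qed
  moreover have e0: "f 0 = g 0" "f 1 = g 1" using ends by (simp_all add: pathstart_def pathfinish_def)
  have "pathstart (?h \<circ> Pair t) = pathstart f" "pathfinish (?h \<circ> Pair t) = pathfinish f" for t
    using fun_cong[OF e0(1)] fun_cong[OF e0(2)]
    by (simp_all add: pathstart_def pathfinish_def fun_eq_iff left_diff_distrib)
  ultimately show ?thesis
    unfolding homotopic_paths by (intro exI[of _ ?h]) auto
qed

text \<open>The straight line between two points with intersecting supports may leave the complex;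
  instead one passes through the normalised minimum, which lies in the common face.\<close>

lemma homotopic_paths_intersecting_supports:
  assumes K: "finite_simplicial_complex K"
    and f: "path f" "path_image f \<subseteq> geometric_realization K"
    and g: "path g" "path_image g \<subseteq> geometric_realization K"
    and ends: "pathstart f = pathstart g" "pathfinish f = pathfinish g"
    and close: "\<And>x. x \<in> {0..1} \<Longrightarrow> \<exists>v. 0 < f x v \<and> 0 < g x v"
  shows "homotopic_paths (geometric_realization K) f g"
proof -
  have finV: "finite (\<Union>K)" using K by (auto simp: finite_simplicial_complex_def)
  \<comment> \<open>The sum runs over all vertices, an index set that does not vary with
    \<open>x\<close>, so \<open>w\<close> is continuous. A common positive coordinate makes
    \<open>w x\<close> positive.\<close>
  define w where "w x = (\<Sum>v\<in>\<Union>K. min (f x v) (g x v))" for x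
  define m where "m x = (\<lambda>v. min (f x v) (g x v) / w x)" for x
  have fg: "f x \<in> geometric_realization K" "g x \<in> geometric_realization K" if "x \<in> {0..1}" for x
    using f g that by (auto simp: path_image_def)
  have nonneg: "0 \<le> f x v" "0 \<le> g x v" if "x \<in> {0..1}" for x v
    using fg[OF that] by (auto simp: geometric_realization_def)
  have supp: "{v. f x v \<noteq> 0} \<in> K" "{v. g x v \<noteq> 0} \<in> K" if "x \<in> {0..1}" for x
    using fg[OF that] by (auto simp: geometric_realization_def)
  have wpos: "0 < w x" if x: "x \<in> {0..1}" for x
  proof -
    obtain v where v: "0 < f x v" "0 < g x v" using close[OF x] by blast
    then have "v \<in> {v. f x v \<noteq> 0}" by simp
    then have "v \<in> \<Union>K" using supp(1)[OF x] by (rule UnionI[rotated])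
    then show ?thesis
      unfolding w_def using finV v nonneg[OF x] by (intro sum_pos2[of _ v]) auto
  qed
  have mK: "m x \<in> geometric_realization K" if x: "x \<in> {0..1}" for x
  proof -
    let ?s = "{v. f x v \<noteq> 0}"
    have sub: "?s \<subseteq> \<Union>K" using supp[OF x] by blast
    have "(\<Sum>v\<in>?s. min (f x v) (g x v)) = w x"
      unfolding w_def using nonneg[OF x] by (intro sum.mono_neutral_left finV sub) auto
    then have "(\<Sum>v\<in>?s. m x v) = 1"
      using wpos[OF x] by (simp add: m_def flip: sum_divide_distrib)
    then show ?thesis
      unfolding geometric_realization_iff[OF K] using supp[OF x] nonneg[OF x] wpos[OF x]
      by (intro bexI[of _ ?s]) (auto simp: m_def min_def)
  qed
  have off: "m x v = 0" if "x \<in> {0..1}" "f x v = 0 \<or> g x v = 0" for x v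
    using that nonneg[OF that(1), of v] by (auto simp: m_def min_def)
  have coord: "continuous_on {0..1} (\<lambda>x. f x v)" "continuous_on {0..1} (\<lambda>x. g x v)" for v
    using f g unfolding path_def by (auto intro: continuous_on_product_then_coordinatewise)
  have "path m"
    unfolding path_def m_def using wpos
    by (intro continuous_on_coordinatewise_then_product continuous_on_divide continuous_on_min coord)
      (auto simp: w_def less_le intro!: continuous_intros coord)
  have "path_image m \<subseteq> geometric_realization K" using mK by (auto simp: path_image_def)
  \<comment> \<open>Where \<open>f\<close> and \<open>g\<close> meet, the minimum is
    \<open>f x\<close> itself, with coordinate sum 1, so the detour keeps the end points.\<close>
  have eq: "m x = f x" if "x \<in> {0..1}" "f x = g x" for x
  proof -
    have sub: "{v. f x v \<noteq> 0} \<subseteq> \<Union>K" using supp[OF that(1)] by blast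
    have "w x = (\<Sum>v | f x v \<noteq> 0. f x v)"
      unfolding w_def that(2)[symmetric] using sub by (simp add: sum.mono_neutral_right[OF finV sub])
    then have "w x = 1" using fg[OF that(1)] by (simp add: geometric_realization_def)
    then show ?thesis using that by (simp add: m_def fun_eq_iff)
  qed
  have mends: "pathstart m = pathstart f" "pathfinish m = pathfinish f"
    using eq[of 0] eq[of 1] ends by (auto simp: pathstart_def pathfinish_def)
  have "homotopic_paths (geometric_realization K) f m"
  proof (rule homotopic_paths_common_simplex[OF K f \<open>path m\<close> \<open>path_image m \<subseteq> _\<close>])
    show "\<exists>s\<in>K. {v. f x v \<noteq> 0} \<subseteq> s \<and> {v. m x v \<noteq> 0} \<subseteq> s" if "x \<in> {0..1}" for x
      using supp(1)[OF that] off[OF that] by (intro bexI[of _ "{v. f x v \<noteq> 0}"]) auto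
  qed (use mends in auto)
  moreover have "homotopic_paths (geometric_realization K) m g"
  proof (rule homotopic_paths_common_simplex[OF K \<open>path m\<close> \<open>path_image m \<subseteq> _\<close> g])
    show "\<exists>s\<in>K. {v. m x v \<noteq> 0} \<subseteq> s \<and> {v. g x v \<noteq> 0} \<subseteq> s" if "x \<in> {0..1}" for x
      using supp(2)[OF that] off[OF that] by (intro bexI[of _ "{v. g x v \<noteq> 0}"]) auto
  qed (use mends ends in auto)
  ultimately show ?thesis by (rule homotopic_paths_trans)
qed

text \<open>By the im kleinen criterion it suffices to join each point of a smaller neighbourhood
  \<open>N\<close> to \<open>u\<close> within \<open>W\<close>. Segments do this: they stay in the
  complex when the support of \<open>u\<close> lies in that of the other point.\<close>

lemma locally_path_connected_geometric_realization:
  assumes K: "finite_simplicial_complex K"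
  shows "locally path_connected (geometric_realization K)"
  unfolding locally_path_connected_im_kleinen
proof (intro allI impI, elim conjE)
  fix W u assume W: "openin (top_of_set (geometric_realization K)) W" and u: "u \<in> W"
  then have uK: "u \<in> geometric_realization K" using openin_imp_subset by blast
  obtain W' where W': "open W'" "W = geometric_realization K \<inter> W'"
    using W by (meson openin_open)
  then have "openin (product_topology (\<lambda>i. euclidean) UNIV) W'" "u \<in> W'"
    using u by (auto simp: euclidean_product_topology)
  then obtain X where X: "u \<in> PiE UNIV X" "\<And>i. open (X i)" "finite {i. X i \<noteq> UNIV}" "PiE UNIV X \<subseteq> W'"
    using product_topology_open_contains_basis[of "\<lambda>_. euclidean" UNIV W' u] by auto
  have "\<exists>e>0. ball (u i) e \<subseteq> X i" for i
  proof -
    have "u i \<in> X i" using X(1) by auto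
    then show ?thesis using X(2)[of i] open_contains_ball by blast
  qed
  then obtain e where e: "\<And>i. 0 < e i" "\<And>i. ball (u i) (e i) \<subseteq> X i" by metis
  \<comment> \<open>The second factor keeps the positive coordinates of \<open>u\<close> positive
    and so forces the inclusion of supports; the first keeps segments in the basic neighbourhood
    given by \<open>X\<close>. Only finitely many \<open>Y i\<close> are restricted, since the
    support of \<open>u\<close> is finite.\<close>
  define Y where "Y i = (if X i = UNIV then UNIV else ball (u i) (e i)) \<inter> (if u i = 0 then UNIV else {0<..})" for i
  define N where "N = geometric_realization K \<inter> PiE UNIV Y"
  have upos: "0 \<le> u i" for i using uK by (simp add: geometric_realization_def)
  have supp: "{i. u i \<noteq> 0} \<in> K" using uK by (simp add: geometric_realization_def)
  then have "finite {i. u i \<noteq> 0}" using K by (auto simp: finite_simplicial_complex_def)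
  then have "finite {i. Y i \<noteq> UNIV}"
    using X(3) by (rule_tac finite_subset[of _ "{i. X i \<noteq> UNIV} \<union> {i. u i \<noteq> 0}"]) (auto simp: Y_def)
  then have "open (PiE UNIV Y)"
    by (intro open_PiE) (auto simp: Y_def)
  then have "openin (top_of_set (geometric_realization K)) N"
    by (auto simp: N_def)
  moreover have "u \<in> N"
    using uK e(1) upos by (auto simp: N_def Y_def less_le)
  moreover have seg: "\<exists>p. path p \<and> path_image p \<subseteq> W \<and> pathstart p = u \<and> pathfinish p = t" if t: "t \<in> N" for t
  proof -
    define p where "p a = (\<lambda>v. (1 - a) * u v + a * t v)" for a :: real
    have tK: "t \<in> geometric_realization K" and tY: "\<And>i. t i \<in> Y i"
      using t by (auto simp: N_def)
    have "{v. u v \<noteq> 0} \<subseteq> {v. t v \<noteq> 0}"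
      using tY by (force simp: Y_def split: if_splits)
    moreover have "{v. t v \<noteq> 0} \<in> K" using tK by (simp add: geometric_realization_def)
    ultimately have pK: "p a \<in> geometric_realization K" if "a \<in> {0..1}" for a
      unfolding p_def by (intro segment_in_geometric_realization[OF K _ uK tK _ _ that]) auto
    have "p a \<in> W'" if a: "a \<in> {0..1}" for a
    proof -
      have "p a i \<in> X i" for i
      proof (cases "X i = UNIV")
        case False
        then have "\<bar>u i - t i\<bar> < e i" using tY[of i] by (auto simp: Y_def dist_real_def)
        moreover have "u i - p a i = a * (u i - t i)"
          by (simp add: p_def algebra_simps)
        then have "\<bar>u i - p a i\<bar> = a * \<bar>u i - t i\<bar>"
          using a by (simp add: abs_mult)
        moreover have "a * \<bar>u i - t i\<bar> \<le> \<bar>u i - t i\<bar>"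
          using a by (intro mult_left_le_one_le) auto
        ultimately show ?thesis using e(2)[of i] by (auto simp: dist_real_def)
      qed auto
      then show ?thesis using X(4) by auto
    qed
    then have "path_image p \<subseteq> W" using W' pK by (auto simp: path_image_def)
    moreover have "path p"
      unfolding path_def p_def
      by (intro continuous_on_coordinatewise_then_product continuous_intros)
    ultimately show ?thesis
      by (intro exI[of _ p]) (auto simp: p_def pathstart_def pathfinish_def)
  qed
  moreover have "N \<subseteq> W"
    using seg by (metis pathfinish_in_path_image subset_iff)
  ultimately show "\<exists>N. openin (top_of_set (geometric_realization K)) N \<and> u \<in> N \<and> N \<subseteq> W \<and>
      (\<forall>y. y \<in> N \<longrightarrow> (\<exists>p. path p \<and> path_image p \<subseteq> W \<and> pathstart p = u \<and> pathfinish p = y))"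
    by blast
qed

text \<open>Supplies the metric in which the uniform estimates are made, as \<open>'b\<close> has a
  topology only.\<close>

lemma finite_polyhedron_embedding:
  fixes P :: "'b::topological_space set"
  assumes "finite_polyhedron P"
  obtains e :: "'b \<Rightarrow> nat \<Rightarrow> real" and e' where "homeomorphism P (e ` P) e e'" "compact (e ` P)"
proof -
  obtain K e e' where "finite_simplicial_complex K" "homeomorphism P (geometric_realization K) e e'"
    using assms unfolding finite_polyhedron_def homeomorphic_def by blast
  then show thesis
    using that[of e e'] compact_geometric_realization[of K] homeomorphism_image1 by metis
qed

text \<open>In an open subset of a locally path connected space, components and path components
  coincide. Thus the connected image of a subset of \<open>X\<close> is enough to obtain a path in
  the polyhedron.\<close>

lemma finite_polyhedron_path_in_open_subset:
  fixes P :: "'b::topological_space set"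
  assumes "finite_polyhedron P" and W: "openin (top_of_set P) W"
    and D: "connected D" "D \<subseteq> W" "x \<in> D" "y \<in> D"
  obtains g where "path g" "path_image g \<subseteq> W" "pathstart g = x" "pathfinish g = y"
proof -
  obtain K e e' where K: "finite_simplicial_complex K"
    and e: "homeomorphism P (geometric_realization K) e e'"
    using assms unfolding finite_polyhedron_def homeomorphic_def by blast
  have WP: "W \<subseteq> P" using W openin_imp_subset by blast
  have "openin (top_of_set (geometric_realization K)) (e ` W)"
    using homeomorphism_imp_open_map[OF e W] .
  then have "locally path_connected (e ` W)"
    using locally_path_connected_geometric_realization[OF K] locally_open_subset by blast
  moreover have "connected (e ` D)"
    using D WP e by (meson connected_continuous_image continuous_on_subset homeomorphism_def order_trans)
  then have "connected_component (e ` W) (e x) (e y)"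
    using D unfolding connected_component_def by blast
  ultimately have "path_component (e ` W) (e x) (e y)"
    using path_component_eq_connected_component_set by blast
  then obtain g where g: "path g" "path_image g \<subseteq> e ` W" "pathstart g = e x" "pathfinish g = e y"
    unfolding path_component_def by blast
  have inv: "e' (e z) = z" if "z \<in> W" for z
    using that WP e by (auto simp: homeomorphism_def)
  have "continuous_on (e ` W) e'"
    using e WP by (metis continuous_on_subset homeomorphism_def image_mono)
  show thesis
  proof
    show "path (e' \<circ> g)"
      using g \<open>continuous_on (e ` W) e'\<close> by (meson continuous_on_subset path_continuous_image)
    show "path_image (e' \<circ> g) \<subseteq> W"
      using g(2) inv by (auto simp: path_image_compose)
    show "pathstart (e' \<circ> g) = x" "pathfinish (e' \<circ> g) = y"
      using g inv D by (auto simp: pathstart_compose pathfinish_compose)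
  qed
qed

text \<open>The cover consists of the open stars of the vertices. Two points in the star of
  \<open>v\<close> both have a positive coordinate at \<open>v\<close>, so their supports
  intersect.\<close>

lemma finite_polyhedron_close_paths_homotopic:
  fixes P :: "'b::topological_space set"
  assumes "finite_polyhedron P"
  obtains \<U> where "\<And>U. U \<in> \<U> \<Longrightarrow> openin (top_of_set P) U" "P \<subseteq> \<Union>\<U>"
    "\<And>f g. \<lbrakk>path f; path_image f \<subseteq> P; path g; path_image g \<subseteq> P; pathstart f = pathstart g;
       pathfinish f = pathfinish g; \<And>x. x \<in> {0..1} \<Longrightarrow> \<exists>U\<in>\<U>. f x \<in> U \<and> g x \<in> U\<rbrakk>
       \<Longrightarrow> homotopic_paths P f g"
proof -
  obtain K e e' where K: "finite_simplicial_complex K"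
    and e: "homeomorphism P (geometric_realization K) e e'"
    using assms unfolding finite_polyhedron_def homeomorphic_def by blast
  have cont: "continuous_on P e" "continuous_on (geometric_realization K) e'"
    and im: "e ` P = geometric_realization K" "e' ` geometric_realization K = P"
    and inv: "\<And>x. x \<in> P \<Longrightarrow> e' (e x) = x"
    using e by (auto simp: homeomorphism_def)
  let ?star = "\<lambda>v. {x \<in> P. 0 < e x v}"
  show thesis
  proof
    fix U assume "U \<in> range ?star"
    then obtain v where U: "U = ?star v" by blast
    have "continuous_on P (\<lambda>x. e x v)"
      using cont(1) by (rule continuous_on_product_then_coordinatewise)
    then have "openin (top_of_set P) (P \<inter> (\<lambda>x. e x v) -` {0<..})"
      by (rule continuous_openin_preimage_gen) simp
    also have "P \<inter> (\<lambda>x. e x v) -` {0<..} = U" by (auto simp: U)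
    finally show "openin (top_of_set P) U" .
  next
    show "P \<subseteq> \<Union>(range ?star)"
    proof
      fix x assume x: "x \<in> P"
      then have "e x \<in> geometric_realization K" using im by blast
      then have "{v. e x v \<noteq> 0} \<in> K" "\<And>v. 0 \<le> e x v" by (auto simp: geometric_realization_def)
      moreover from this have "{v. e x v \<noteq> 0} \<noteq> {}"
        using K unfolding finite_simplicial_complex_def by blast
      ultimately obtain v where "0 < e x v" by (metis (mono_tags) Collect_empty_eq less_le)
      then show "x \<in> \<Union>(range ?star)" using x by blast
    qed
  next
    fix f g
    assume fg: "path f" "path_image f \<subseteq> P" "path g" "path_image g \<subseteq> P" "pathstart f = pathstart g"
       "pathfinish f = pathfinish g" "\<And>x. x \<in> {0..1} \<Longrightarrow> \<exists>U\<in>range ?star. f x \<in> U \<and> g x \<in> U"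
    have "homotopic_paths (geometric_realization K) (e \<circ> f) (e \<circ> g)"
    proof (rule homotopic_paths_intersecting_supports[OF K])
      show "path (e \<circ> f)" "path (e \<circ> g)"
        using fg cont(1) by (auto intro!: path_continuous_image intro: continuous_on_subset)
      show "path_image (e \<circ> f) \<subseteq> geometric_realization K" "path_image (e \<circ> g) \<subseteq> geometric_realization K"
        unfolding path_image_compose im(1)[symmetric] using fg by (auto intro: image_mono)
      show "pathstart (e \<circ> f) = pathstart (e \<circ> g)" "pathfinish (e \<circ> f) = pathfinish (e \<circ> g)"
        using fg by (auto simp: pathstart_compose pathfinish_compose)
      show "\<exists>v. 0 < (e \<circ> f) x v \<and> 0 < (e \<circ> g) x v" if "x \<in> {0..1}" for x
        using fg(7)[OF that] by auto
    qed
    then have "homotopic_paths P (e' \<circ> (e \<circ> f)) (e' \<circ> (e \<circ> g))"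
      by (rule homotopic_paths_continuous_image) (use cont im in auto)
    moreover have "homotopic_paths P f (e' \<circ> (e \<circ> f))" "homotopic_paths P g (e' \<circ> (e \<circ> g))"
      using fg by (auto intro!: homotopic_paths_eq simp: inv path_image_def image_subset_iff)
    ultimately show "homotopic_paths P f g"
      by (metis homotopic_paths_sym homotopic_paths_trans)
  qed
qed

section \<open>Inverse limits of polyhedra\<close>

lemma compact_decreasing_closed_Inter:
  fixes A :: "nat \<Rightarrow> 'a::topological_space set"
  assumes "compact S" "\<And>n. closed (A n)" "\<And>m n. m \<le> n \<Longrightarrow> A n \<subseteq> A m" "\<And>n. S \<inter> A n \<noteq> {}"
  shows "S \<inter> (\<Inter>n. A n) \<noteq> {}"
proof (rule compact_imp_fip_image[OF assms(1,2)])
  fix I :: "nat set" assume I: "finite I"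
  \<comment> \<open>Inserting 0 covers the case of an empty \<open>I\<close>.\<close>
  then have "A (Max (insert 0 I)) \<subseteq> (\<Inter>n\<in>I. A n)"
    by (intro INT_greatest assms(3)) auto
  then show "S \<inter> (\<Inter>n\<in>I. A n) \<noteq> {}" using assms(4) by blast
qed

text \<open>\<open>\<delta>\<close> is a Lebesgue number of a cover by open sets whose traces on
  \<open>X\<close> lie in small connected sets. These lie in balls of radius
  \<open>\<epsilon>/2\<close> about other centres \<open>z\<close>, so that they fit into
  \<open>ball x \<epsilon>\<close>.\<close>

lemma uniformly_locally_connected:
  fixes X :: "'a::metric_space set"
  assumes "compact X" "locally connected X" "0 < \<epsilon>"
  obtains \<delta> where "0 < \<delta>"
    "\<And>x y. \<lbrakk>x \<in> X; y \<in> X; dist x y < \<delta>\<rbrakk> \<Longrightarrow> \<exists>C. connected C \<and> C \<subseteq> X \<inter> ball x \<epsilon> \<and> x \<in> C \<and> y \<in> C"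
proof -
  let ?\<G> = "{V. open V \<and> (\<exists>C z. connected C \<and> X \<inter> V \<subseteq> C \<and> C \<subseteq> X \<inter> ball z (\<epsilon>/2))}"
  have sub: "X \<subseteq> \<Union>?\<G>"
  proof
    fix z assume z: "z \<in> X"
    have "openin (top_of_set X) (X \<inter> ball z (\<epsilon>/2))" by (simp add: openin_open_Int)
    then obtain u C where uC: "openin (top_of_set X) u" "connected C" "z \<in> u" "u \<subseteq> C" "C \<subseteq> X \<inter> ball z (\<epsilon>/2)"
      using locallyE[OF assms(2), of "X \<inter> ball z (\<epsilon>/2)" z] z \<open>0 < \<epsilon>\<close> by auto
    then obtain V where "open V" "u = X \<inter> V" by (auto simp: openin_open)
    then have "V \<in> ?\<G>" "z \<in> V" using uC by auto
    then show "z \<in> \<Union>?\<G>" by blast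
  qed
  obtain \<delta> where \<delta>: "0 < \<delta>" "\<And>x. x \<in> X \<Longrightarrow> \<exists>V\<in>?\<G>. ball x \<delta> \<subseteq> V"
    by (rule Heine_Borel_lemma[OF assms(1) sub]) auto
  show thesis
  proof
    fix x y assume xy: "x \<in> X" "y \<in> X" "dist x y < \<delta>"
    obtain V where "V \<in> ?\<G>" "ball x \<delta> \<subseteq> V" using \<delta>(2)[OF xy(1)] by (elim bexE)
    then obtain C z where V: "ball x \<delta> \<subseteq> V" "connected C" "X \<inter> V \<subseteq> C" "C \<subseteq> X \<inter> ball z (\<epsilon>/2)"
      by (elim CollectE exE conjE)
    have "x \<in> ball x \<delta>" "y \<in> ball x \<delta>" using xy \<delta>(1) by auto
    then have "x \<in> C" "y \<in> C" using xy V by blast+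
    moreover have "C \<subseteq> ball x \<epsilon>"
    proof
      fix w assume "w \<in> C"
      then have "dist z w < \<epsilon>/2" "dist z x < \<epsilon>/2" using V(4) \<open>x \<in> C\<close> by auto
      then show "w \<in> ball x \<epsilon>" using dist_triangle_half_r[of z x \<epsilon> w] by simp
    qed
    ultimately show "\<exists>C. connected C \<and> C \<subseteq> X \<inter> ball x \<epsilon> \<and> x \<in> C \<and> y \<in> C"
      using V by blast
  qed (fact \<delta>)
qed

text \<open>Otherwise each \<open>P j\<close> with \<open>j > k\<close> has a point whose image in
  \<open>P k\<close> misses \<open>V\<close>. Such a point and its images at lower levels form a
  partial thread, and compactness of the product yields a full thread with \<open>k\<close>-th
  coordinate outside \<open>V\<close>, against \<open>lim\<close>.\<close>

lemma inverse_limit_images_shrink: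
  fixes P :: "nat \<Rightarrow> 'b::topological_space set"
  assumes poly: "\<And>i. finite_polyhedron (P i)" and seq: "inverse_sequence_spaces P p"
    and V: "openin (top_of_set (P k)) V"
    and lim: "\<And>x. x \<in> inverse_limit_space P p \<Longrightarrow> x k \<in> V"
  shows "\<exists>j>k. p k j ` P j \<subseteq> V"
proof (rule ccontr)
  assume "\<not> ?thesis"
  then have "\<exists>y. y \<in> P j \<and> p k j y \<notin> V" if "k < j" for j using that by blast
  then obtain y where y: "\<And>j. k < j \<Longrightarrow> y j \<in> P j" "\<And>j. k < j \<Longrightarrow> p k j (y j) \<notin> V" by metis
  have p: "continuous_on (P j) (p i j)" "p i j ` P j \<subseteq> P i" if "i < j" for i j
    using seq that by (auto simp: inverse_sequence_spaces_def)
  have pp: "p i j (p j l x) = p i l x" if "i < j" "j < l" "x \<in> P l" for i j l x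
    using seq that by (auto simp: inverse_sequence_spaces_def)
  have "\<exists>e e'. homeomorphism (P i) (e ` P i) e e' \<and> compact ((e :: 'b \<Rightarrow> nat \<Rightarrow> real) ` P i)" for i
    using finite_polyhedron_embedding[OF poly] by metis
  then obtain e :: "nat \<Rightarrow> 'b \<Rightarrow> nat \<Rightarrow> real" and e' where
    e: "\<And>i. homeomorphism (P i) (e i ` P i) (e i) (e' i)" and comp: "\<And>i. compact (e i ` P i)"
    by metis
  have ce: "continuous_on (P i) (e i)" "continuous_on (e i ` P i) (e' i)" "x \<in> P i \<Longrightarrow> e' i (e i x) = x" for i x
    using e[of i] by (auto simp: homeomorphism_def)
  have PI: "\<exists>z. z \<in> P i" for i
  proof (cases "k < i")
    case False
    then have "p i (Suc k) (y (Suc k)) \<in> P i" using p(2)[of i "Suc k"] y(1)[of "Suc k"] by auto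
    then show ?thesis ..
  qed (use y in blast)
  then obtain z where z: "\<And>i. z i \<in> P i" by metis
  define T where "T = PiE UNIV (\<lambda>i. e i ` P i)"
  have "compactin (product_topology (\<lambda>_::nat. euclidean) UNIV) T"
    unfolding T_def compactin_PiE using comp by simp
  then have T: "compact T" by (simp add: euclidean_product_topology)
  then have clT: "closed T" by (rule compact_imp_closed)
  have coord: "continuous_on T (\<lambda>t. t i)" for i
    by (rule continuous_on_subset[OF continuous_on_product_coordinates]) simp
  have Ti: "t i \<in> e i ` P i" if "t \<in> T" for i t
    using that by (auto simp: T_def PiE_iff)
  have e't: "continuous_on T (\<lambda>t. e' i (t i))" "t \<in> T \<Longrightarrow> e' i (t i) \<in> P i" for i t
  proof -
    show "continuous_on T (\<lambda>t. e' i (t i))"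
      by (rule continuous_on_compose2[OF ce(2) coord]) (use Ti in blast)
    show "e' i (t i) \<in> P i" if "t \<in> T"
      using Ti[OF that, of i] ce(3) by force
  qed
  \<comment> \<open>Compatibility of levels \<open>i\<close> and \<open>j\<close>, written with a
    distance to exhibit it as a closed condition; \<open>A n\<close> asks for it up to level
    \<open>n\<close>.\<close>
  define B where "B i j = {t \<in> T. dist (e i (p i j (e' j (t j)))) (t i) \<le> 0}" for i j
  define D where "D = T \<inter> (\<lambda>t. e' k (t k)) -` (P k - V)"
  define A where "A n = D \<inter> (\<Inter>j\<in>{..n}. \<Inter>i\<in>{..<j}. B i j)" for n
  have clB: "closed (B i j)" if "i < j" for i j
    unfolding B_def
  proof (rule continuous_on_closed_Collect_le[OF _ _ clT])
    have "continuous_on T (\<lambda>t. p i j (e' j (t j)))"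
      using continuous_on_compose2[OF p(1)[OF that] e't(1)] e't(2) by blast
    then have "continuous_on T (\<lambda>t. e i (p i j (e' j (t j))))"
      by (rule continuous_on_compose2[OF ce(1)]) (use e't(2) p(2)[OF that] in blast)
    then show "continuous_on T (\<lambda>t. dist (e i (p i j (e' j (t j)))) (t i))"
      using coord by (intro continuous_on_dist)
  qed simp
  have clD: "closed D"
    unfolding D_def
  proof (rule closedin_closed_trans[OF continuous_closedin_preimage_gen clT])
    show "closedin (top_of_set (P k)) (P k - V)" using V by (simp add: closedin_diff)
  qed (use e't in auto)
  have "T \<inter> (\<Inter>n. A n) \<noteq> {}"
  proof (rule compact_decreasing_closed_Inter[OF T])
    show "closed (A n)" for n
      unfolding A_def by (intro closed_Int clD closed_INT ballI clB) auto
    show "A n \<subseteq> A m" if "m \<le> n" for m n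
      using that unfolding A_def by fastforce
    show "T \<inter> A n \<noteq> {}" for n
    proof -
      define N where "N = Suc (max n k)"
      have N: "n < N" "k < N" by (auto simp: N_def)
      \<comment> \<open>Below \<open>N\<close> these are images of \<open>y N\<close>, from
        \<open>N\<close> on arbitrary points: \<open>A n\<close> inspects only levels up to
        \<open>max n k\<close>.\<close>
      define t where "t i = (if i < N then e i (p i N (y N)) else e i (z i))" for i
      have yN: "y N \<in> P N" "p k N (y N) \<notin> V" using y N by auto
      have pN: "p i N (y N) \<in> P i" if "i < N" for i using p(2)[OF that] yN by blast
      have "t \<in> T" using pN z by (auto simp: T_def t_def)
      moreover have "t \<in> D"
        using \<open>t \<in> T\<close> yN pN[OF N(2)] N by (simp add: D_def t_def ce(3))
      moreover have "t \<in> B i j" if "i < j" "j \<le> n" for i j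
        using that N \<open>t \<in> T\<close> pN[of j] pp[of i j N] yN by (simp add: B_def t_def ce(3))
      ultimately show ?thesis unfolding A_def by blast
    qed
  qed
  then obtain t where t: "t \<in> T" "\<And>n. t \<in> A n" by blast
  have "t \<in> B i j" if "i < j" for i j using t(2)[of j] that unfolding A_def by blast
  then have eq: "e i (p i j (e' j (t j))) = t i" if "i < j" for i j using that by (auto simp: B_def)
  have "p i j (e' j (t j)) = e' i (t i)" if "i < j" for i j
    using eq[OF that] ce(3) e't(2)[OF t(1)] p(2)[OF that] by (metis image_subset_iff)
  then have "(\<lambda>i. e' i (t i)) \<in> inverse_limit_space P p"
    using e't(2)[OF t(1)] by (simp add: inverse_limit_space_def)
  then have "e' k (t k) \<in> V" using lim by blast
  moreover have "t \<in> D" using t(2)[of 0] unfolding A_def by blast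
  ultimately show False unfolding D_def by blast
qed

text \<open>Among the pairs in \<open>S\<close>, those at distance at least \<open>\<delta>\<close>,
  the ones identified by \<open>q n\<close> form a decreasing sequence of closed sets with empty
  intersection by \<open>inj\<close>. So some level \<open>k\<close> beyond \<open>i\<close>
  separates all pairs in \<open>S\<close>, and by compactness the distances at that level have a
  positive lower bound on \<open>S\<close>.\<close>

lemma inverse_limit_separates_uniformly:
  fixes X :: "'a::metric_space set" and P :: "nat \<Rightarrow> 'b::topological_space set"
    and e :: "nat \<Rightarrow> 'b \<Rightarrow> 'c::metric_space"
  assumes "compact X" and q: "\<And>i. continuous_on X (q i)" "\<And>i. q i ` X \<subseteq> P i"
    and e: "\<And>i. continuous_on (P i) (e i)" "\<And>i. inj_on (e i) (P i)"
    and pq: "\<And>i j x. i < j \<Longrightarrow> x \<in> X \<Longrightarrow> p i j (q j x) = q i x"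
    and inj: "\<And>x y. \<lbrakk>x \<in> X; y \<in> X; \<And>i. q i x = q i y\<rbrakk> \<Longrightarrow> x = y"
    and "0 < \<delta>"
  obtains k \<epsilon> where "i < k" "0 < \<epsilon>"
    "\<And>x y. \<lbrakk>x \<in> X; y \<in> X; dist (e k (q k x)) (e k (q k y)) < \<epsilon>\<rbrakk> \<Longrightarrow> dist x y < \<delta>"
proof -
  define g where "g k z = dist (e k (q k (fst z))) (e k (q k (snd z)))" for k z
  define S where "S = {z \<in> X \<times> X. \<delta> \<le> dist (fst z) (snd z)}"
  have clXX: "closed (X \<times> X)" using assms(1) compact_imp_closed by (intro closed_Times) auto
  have "closed S"
    unfolding S_def by (intro continuous_on_closed_Collect_le clXX continuous_intros)
  then have S: "compact S"
    using compact_Int_closed[OF compact_Times[OF assms(1,1)]] by (metis (no_types, lifting) S_def inf.absorb_iff2 mem_Collect_eq subsetI)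
  have eq: "continuous_on X (\<lambda>x. e k (q k x))" for k
    using continuous_on_compose2[OF e(1) q(1) q(2)] .
  have "continuous_on (X \<times> X) (g k)" for k
    unfolding g_def
    by (intro continuous_on_dist continuous_on_compose2[OF eq] continuous_intros) auto
  then have g: "continuous_on S (g k)" for k
    by (rule continuous_on_subset) (auto simp: S_def)
  define A where "A n = {z \<in> S. g n z \<le> 0}" for n
  have A: "z \<in> A n \<longleftrightarrow> z \<in> S \<and> q n (fst z) = q n (snd z)" for n z
    using q(2)[of n] e(2)[of n] by (auto simp: A_def g_def S_def inj_on_def image_subset_iff)
  have "\<exists>k>i. A k = {}"
  proof (rule ccontr)
    assume no: "\<not> ?thesis"
    have dec: "A n \<subseteq> A m" if "m \<le> n" for m n
    proof (cases "m = n")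
      case False
      then have "m < n" using that by simp
      show ?thesis
      proof
        fix z assume "z \<in> A n"
        then show "z \<in> A m"
          unfolding A using pq[OF \<open>m < n\<close>, of "fst z"] pq[OF \<open>m < n\<close>, of "snd z"]
          by (auto simp: S_def)
      qed
    qed simp
    have "S \<inter> (\<Inter>n. A n) \<noteq> {}"
    proof (rule compact_decreasing_closed_Inter[OF S])
      show "closed (A n)" for n
        unfolding A_def by (intro continuous_on_closed_Collect_le g \<open>closed S\<close> continuous_intros)
      show "S \<inter> A n \<noteq> {}" for n
      proof -
        have "A (Suc (max n i)) \<noteq> {}" using no by (metis less_Suc_eq_le max.cobounded2)
        moreover have "A (Suc (max n i)) \<subseteq> A n" by (rule dec) simp
        moreover have "A n \<subseteq> S" by (auto simp: A_def)
        ultimately show ?thesis by blast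
      qed
    qed (fact dec)
    then obtain z where z: "z \<in> S" "\<And>n. q n (fst z) = q n (snd z)" using A by blast
    then have "fst z = snd z" using inj by (auto simp: S_def)
    then show False using z \<open>0 < \<delta>\<close> by (auto simp: S_def)
  qed
  then obtain k where k: "i < k" "A k = {}" by blast
  have pos: "0 < g k z" if "z \<in> S" for z
  proof (rule ccontr)
    assume "\<not> 0 < g k z"
    then have "z \<in> A k" using that by (simp add: A_def)
    then show False using k(2) by simp
  qed
  obtain \<epsilon> where \<epsilon>: "0 < \<epsilon>" "\<And>z. z \<in> S \<Longrightarrow> \<epsilon> \<le> g k z"
  proof (cases "S = {}")
    case False
    then obtain z where "z \<in> S" "\<forall>w\<in>S. g k z \<le> g k w"
      using continuous_attains_inf[OF S _ g] by blast
    then show thesis using that[of "g k z"] pos by blast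
  qed (use that[of 1] in auto)
  show thesis
  proof
    fix x y assume "x \<in> X" "y \<in> X" "dist (e k (q k x)) (e k (q k y)) < \<epsilon>"
    then show "dist x y < \<delta>"
      using \<epsilon>(2)[of "(x, y)"] by (force simp: S_def g_def)
  qed (use k \<epsilon> in auto)
qed

text \<open>The level \<open>k\<close> is fine enough for \<open>\<epsilon>\<close>-closeness there (measured through the embedding \<open>E\<close>) to
  control both connected sets in \<open>X\<close> and images in \<open>P i\<close>; the level \<open>j\<close> is so far out that its image
  in \<open>P k\<close> stays close to the finite subset \<open>q k ` F\<close> of the image of \<open>X\<close>.\<close>

lemma inverse_limit_fine_levels:
  fixes X :: "'a::metric_space set" and P :: "nat \<Rightarrow> 'b::topological_space set"
  assumes X: "compact X" "locally connected X"
    and poly: "\<And>i. finite_polyhedron (P i)" and seq: "inverse_sequence_spaces P p"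
    and q: "\<And>i. continuous_on X (q i)" "\<And>i. q i ` X \<subseteq> P i"
    and pq: "\<And>i j x. i < j \<Longrightarrow> x \<in> X \<Longrightarrow> p i j (q j x) = q i x"
    and inj: "\<And>x y. \<lbrakk>x \<in> X; y \<in> X; \<And>i. q i x = q i y\<rbrakk> \<Longrightarrow> x = y"
    and surj: "\<And>y. y \<in> inverse_limit_space P p \<Longrightarrow> \<exists>x\<in>X. \<forall>i. q i x = y i"
    and \<U>: "\<And>U. U \<in> \<U> \<Longrightarrow> openin (top_of_set (P i)) U" "P i \<subseteq> \<Union>\<U>"
    and x0: "x0 \<in> X"
  obtains k j F U \<epsilon> and E :: "'b \<Rightarrow> nat \<Rightarrow> real" where
    "i < k" "k < j" "continuous_on (P k) E" "0 < \<epsilon>" "finite F" "F \<subseteq> X" "x0 \<in> F"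
    "\<And>w. w \<in> P j \<Longrightarrow> \<exists>z\<in>F. dist (E (p k j w)) (E (q k z)) < \<epsilon>/3"
    "\<And>z. z \<in> F \<Longrightarrow> U z \<in> \<U>"
    "\<And>z w. \<lbrakk>z \<in> F; w \<in> P k; dist (E w) (E (q k z)) < \<epsilon>\<rbrakk> \<Longrightarrow> p i k w \<in> U z"
    "\<And>z y. \<lbrakk>z \<in> F; y \<in> F; dist (E (q k z)) (E (q k y)) < \<epsilon>\<rbrakk>
       \<Longrightarrow> \<exists>C. connected C \<and> C \<subseteq> X \<and> z \<in> C \<and> y \<in> C \<and> q i ` C \<subseteq> U z"
proof -
  have p: "continuous_on (P j) (p i j)" "p i j ` P j \<subseteq> P i" if "i < j" for i j
    using seq that by (auto simp: inverse_sequence_spaces_def)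
  have "\<exists>e e'. homeomorphism (P i) (e ` P i) e e' \<and> compact ((e :: 'b \<Rightarrow> nat \<Rightarrow> real) ` P i)" for i
    using finite_polyhedron_embedding[OF poly] by metis
  then obtain e :: "nat \<Rightarrow> 'b \<Rightarrow> nat \<Rightarrow> real" and e' where
    e: "\<And>i. homeomorphism (P i) (e i ` P i) (e i) (e' i)" and comp: "\<And>i. compact (e i ` P i)"
    by metis
  have ce: "continuous_on (P i) (e i)" "continuous_on (e i ` P i) (e' i)" "x \<in> P i \<Longrightarrow> e' i (e i x) = x" for i x
    using e[of i] by (auto simp: homeomorphism_def)
  have ceq: "continuous_on X (\<lambda>x. e i (q i x))" for i
    using continuous_on_compose2[OF ce(1) q(1) q(2)] .
  \<comment> \<open>\<open>\<eta>\<close> is a Lebesgue number of \<open>\<U>\<close>, measured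
    through the embedding \<open>e i\<close>.\<close>
  obtain \<eta> where "0 < \<eta>" and \<eta>: "\<And>w. w \<in> P i \<Longrightarrow> \<exists>U\<in>\<U>. \<forall>w'\<in>P i. dist (e i w) (e i w') < \<eta> \<longrightarrow> w' \<in> U"
  proof -
    let ?\<G> = "{V. open V \<and> (\<exists>U\<in>\<U>. e i ` P i \<inter> V \<subseteq> e i ` U)}"
    have "e i ` P i \<subseteq> \<Union>?\<G>"
    proof (rule image_subsetI)
      fix w assume "w \<in> P i"
      then obtain U where U: "U \<in> \<U>" "w \<in> U" using \<U>(2) by blast
      then obtain V where "open V" "e i ` U = e i ` P i \<inter> V"
        using homeomorphism_imp_open_map[OF e \<U>(1)[OF U(1)]] by (auto simp: openin_open)
      then have "V \<in> ?\<G>" "e i w \<in> V" using U by blast+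
      then show "e i w \<in> \<Union>?\<G>" by blast
    qed
    then obtain \<eta> where \<eta>: "0 < \<eta>" "\<And>x. x \<in> e i ` P i \<Longrightarrow> \<exists>V\<in>?\<G>. ball x \<eta> \<subseteq> V"
      using Heine_Borel_lemma[OF comp, of i ?\<G>] by blast
    show thesis
    proof
      fix w assume w: "w \<in> P i"
      then obtain V U where V: "ball (e i w) \<eta> \<subseteq> V" "U \<in> \<U>" "e i ` P i \<inter> V \<subseteq> e i ` U" using \<eta>(2) by blast
      have "w' \<in> U" if "w' \<in> P i" "dist (e i w) (e i w') < \<eta>" for w'
      proof -
        have "e i w' \<in> ball (e i w) \<eta>" using that by simp
        then have "e i w' \<in> e i ` U" using V that by blast
        then show ?thesis
          using ce(3) that openin_imp_subset[OF \<U>(1)[OF V(2)]] by (metis imageE subsetD)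
      qed
      then show "\<exists>U\<in>\<U>. \<forall>w'\<in>P i. dist (e i w) (e i w') < \<eta> \<longrightarrow> w' \<in> U" using V(2) by blast
    qed (fact \<eta>)
  qed
  \<comment> \<open>The chain of constants: \<open>\<epsilon>'\<close>-close points of
    \<open>X\<close> are \<open>\<eta>\<close>-close at level \<open>i\<close>,
    \<open>\<delta>\<close>-close points lie in a connected subset of an
    \<open>\<epsilon>'\<close>-ball, and closeness at level \<open>k\<close> forces
    \<open>\<delta>\<close>-closeness in \<open>X\<close>.\<close>
  have "uniformly_continuous_on X (\<lambda>x. e i (q i x))"
    by (rule compact_uniformly_continuous[OF ceq X(1)])
  then obtain \<epsilon>' where "0 < \<epsilon>'"
    and \<epsilon>': "\<And>x y. \<lbrakk>x \<in> X; y \<in> X; dist y x < \<epsilon>'\<rbrakk> \<Longrightarrow> dist (e i (q i y)) (e i (q i x)) < \<eta>"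
    unfolding uniformly_continuous_on_def using \<open>0 < \<eta>\<close> by metis
  obtain \<delta> where "0 < \<delta>" and \<delta>: "\<And>x y. \<lbrakk>x \<in> X; y \<in> X; dist x y < \<delta>\<rbrakk>
      \<Longrightarrow> \<exists>C. connected C \<and> C \<subseteq> X \<inter> ball x \<epsilon>' \<and> x \<in> C \<and> y \<in> C"
    by (rule uniformly_locally_connected[OF X \<open>0 < \<epsilon>'\<close>]) (rule that)
  have inj_e: "inj_on (e i) (P i)" for i by (metis ce(3) inj_onI)
  obtain k \<epsilon>1 where k: "i < k" and "0 < \<epsilon>1" and \<epsilon>1: "\<And>x y. \<lbrakk>x \<in> X; y \<in> X; dist (e k (q k x)) (e k (q k y)) < \<epsilon>1\<rbrakk>
      \<Longrightarrow> dist x y < \<delta>"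
    by (rule inverse_limit_separates_uniformly[where e = e and q = q and p = p and P = P and X = X and i = i
          and \<delta> = \<delta>, OF X(1) q ce(1) inj_e pq inj \<open>0 < \<delta>\<close>]) (assumption | rule that)+
  have "continuous_on (e k ` P k) (\<lambda>x. e i (p i k (e' k x)))"
  proof -
    have "e' k ` e k ` P k \<subseteq> P k" using ce(3) by auto
    then have "continuous_on (e k ` P k) (\<lambda>x. p i k (e' k x))"
      by (rule continuous_on_compose2[OF p(1)[OF k] ce(2)])
    then show ?thesis
      by (rule continuous_on_compose2[OF ce(1)]) (use ce(3) p(2)[OF k] in auto)
  qed
  then have "uniformly_continuous_on (e k ` P k) (\<lambda>x. e i (p i k (e' k x)))"
    by (rule compact_uniformly_continuous[OF _ comp])
  then obtain \<epsilon>2 where "0 < \<epsilon>2" and "\<forall>x\<in>e k ` P k. \<forall>y\<in>e k ` P k. dist y x < \<epsilon>2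
      \<longrightarrow> dist (e i (p i k (e' k y))) (e i (p i k (e' k x))) < \<eta>"
    unfolding uniformly_continuous_on_def using \<open>0 < \<eta>\<close> by metis
  then have \<epsilon>2: "dist (e i (p i k w)) (e i (p i k w')) < \<eta>"
    if "w \<in> P k" "w' \<in> P k" "dist (e k w) (e k w') < \<epsilon>2" for w w'
    using that by (simp add: ce(3))
  \<comment> \<open>\<open>\<epsilon>1\<close> provides the connected sets in \<open>X\<close>,
    \<open>\<epsilon>2\<close> the control of images in \<open>P i\<close>.\<close>
  define \<epsilon> where "\<epsilon> = min \<epsilon>1 \<epsilon>2"
  have "0 < \<epsilon>" using \<open>0 < \<epsilon>1\<close> \<open>0 < \<epsilon>2\<close> by (simp add: \<epsilon>_def)
  have cX: "compact ((\<lambda>x. e k (q k x)) ` X)"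
    using compact_continuous_image[OF ceq X(1)] .
  \<comment> \<open>Thirds, because consecutive points of the chain are later compared through two
    points of the loop, which gives three distances.\<close>
  have sub: "(\<lambda>x. e k (q k x)) ` X \<subseteq> (\<Union>z\<in>X. ball (e k (q k z)) (\<epsilon>/3))"
    using \<open>0 < \<epsilon>\<close> by force
  obtain F0 where F0: "F0 \<subseteq> X" "finite F0"
      "(\<lambda>x. e k (q k x)) ` X \<subseteq> (\<Union>z\<in>F0. ball (e k (q k z)) (\<epsilon>/3))"
    by (rule compactE_image[of "(\<lambda>x. e k (q k x)) ` X" X "\<lambda>z. ball (e k (q k z)) (\<epsilon>/3)",
          OF cX open_ball sub])
  \<comment> \<open>\<open>x0\<close> is added so that chains may begin and end at the base
    point.\<close>
  define F where "F = insert x0 F0"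
  have F: "finite F" "F \<subseteq> X" "x0 \<in> F" using F0 x0 by (auto simp: F_def)
  define N where "N = P k \<inter> e k -` (\<Union>z\<in>F. ball (e k (q k z)) (\<epsilon>/3))"
  have Nop: "openin (top_of_set (P k)) N"
    unfolding N_def by (rule continuous_openin_preimage_gen[OF ce(1)]) auto
  \<comment> \<open>Every thread comes from a point of \<open>X\<close>, so the open set
    \<open>N\<close> contains the image of the limit and hence that of some late
    \<open>P j\<close>.\<close>
  have Nlim: "x k \<in> N" if x: "x \<in> inverse_limit_space P p" for x
  proof -
    obtain x' where x': "x' \<in> X" "q k x' = x k" using surj[OF x] by blast
    have "e k (q k x') \<in> (\<Union>z\<in>F0. ball (e k (q k z)) (\<epsilon>/3))"
      by (rule subsetD[OF F0(3)]) (rule imageI[OF x'(1)])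
    moreover have "q k x' \<in> P k" by (rule subsetD[OF q(2)]) (rule imageI[OF x'(1)])
    ultimately have "q k x' \<in> N" by (simp add: N_def F_def)
    then show ?thesis by (simp only: x'(2))
  qed
  have "\<exists>j>k. p k j ` P j \<subseteq> N"
    by (rule inverse_limit_images_shrink[OF poly seq Nop]) (rule Nlim)
  then obtain j where j: "k < j" "p k j ` P j \<subseteq> N" by (elim exE conjE)
  have "\<forall>z\<in>X. \<exists>V. V \<in> \<U> \<and> (\<forall>w'\<in>P i. dist (e i (q i z)) (e i w') < \<eta> \<longrightarrow> w' \<in> V)"
  proof
    fix z assume "z \<in> X"
    then have "q i z \<in> P i" using q(2)[of i] by blast
    from \<eta>[OF this] show "\<exists>V. V \<in> \<U> \<and> (\<forall>w'\<in>P i. dist (e i (q i z)) (e i w') < \<eta> \<longrightarrow> w' \<in> V)"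
      by (elim bexE) (intro exI conjI)
  qed
  from bchoice[OF this] obtain U where
    U': "\<forall>z\<in>X. U z \<in> \<U> \<and> (\<forall>w'\<in>P i. dist (e i (q i z)) (e i w') < \<eta> \<longrightarrow> w' \<in> U z)"
    by (elim exE)
  then have U: "\<And>z. z \<in> X \<Longrightarrow> U z \<in> \<U>"
      "\<And>z w'. \<lbrakk>z \<in> X; w' \<in> P i; dist (e i (q i z)) (e i w') < \<eta>\<rbrakk> \<Longrightarrow> w' \<in> U z"
    by simp_all
  show thesis
  proof (rule that[OF k j(1) ce(1) \<open>0 < \<epsilon>\<close> F])
    show "\<exists>z\<in>F. dist (e k (p k j w)) (e k (q k z)) < \<epsilon>/3" if "w \<in> P j" for w
      using that j(2) unfolding N_def by (fastforce simp: dist_commute)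
    show "U z \<in> \<U>" if "z \<in> F" for z using that F U by blast
    show "p i k w \<in> U z" if "z \<in> F" "w \<in> P k" "dist (e k w) (e k (q k z)) < \<epsilon>" for z w
    proof (rule U(2))
      have z: "z \<in> X" "q k z \<in> P k" using that F q(2) by auto
      have "dist (e i (p i k (q k z))) (e i (p i k w)) < \<eta>"
        using that z by (intro \<epsilon>2) (auto simp: dist_commute \<epsilon>_def)
      then show "dist (e i (q i z)) (e i (p i k w)) < \<eta>" using pq[OF k z(1)] by simp
      show "p i k w \<in> P i" using p(2)[OF k] that by blast
    qed (use that F in blast)
    show "\<exists>C. connected C \<and> C \<subseteq> X \<and> z \<in> C \<and> y \<in> C \<and> q i ` C \<subseteq> U z"
      if close: "z \<in> F" "y \<in> F" "dist (e k (q k z)) (e k (q k y)) < \<epsilon>" for z y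
    proof -
      have zy: "z \<in> X" "y \<in> X" using close F by auto
      have "dist (e k (q k z)) (e k (q k y)) < \<epsilon>1" using close(3) by (simp add: \<epsilon>_def)
      from \<delta>[OF zy \<epsilon>1[OF zy this]]
      obtain C where C: "connected C" "C \<subseteq> X \<inter> ball z \<epsilon>'" "z \<in> C" "y \<in> C"
        by (elim exE conjE)
      have "q i c \<in> U z" if "c \<in> C" for c
      proof (rule U(2)[OF zy(1)])
        have c: "c \<in> X" "dist z c < \<epsilon>'" using that C(2) by auto
        show "q i c \<in> P i" using c q(2)[of i] by blast
        show "dist (e i (q i z)) (e i (q i c)) < \<eta>" by (rule \<epsilon>'[OF c(1) zy(1) c(2)])
      qed
      then show ?thesis using C by blast
    qed
  qed
qed

text \<open>Provides the assumption \<open>fg\<close> of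
  \<open>countable_homomorphisms_inverse_limit\<close>. For each \<open>l \<ge> j\<close> the set
  \<open>S\<close> has one class for each pair of close points of \<open>F\<close>; it depends on
  \<open>l\<close> but not on the loop to be rewritten.\<close>

lemma inverse_limit_fundamental_group_images:
  fixes X :: "'a::metric_space set" and P :: "nat \<Rightarrow> 'b::topological_space set"
  assumes X: "peano_continuum X"
    and poly: "\<And>i. finite_polyhedron (P i)" and seq: "inverse_sequence_spaces P p"
    and q: "\<And>i. continuous_on X (q i)" "\<And>i. q i ` X \<subseteq> P i"
    and pq: "\<And>i j x. i < j \<Longrightarrow> x \<in> X \<Longrightarrow> p i j (q j x) = q i x"
    and inj: "\<And>x y. \<lbrakk>x \<in> X; y \<in> X; \<And>i. q i x = q i y\<rbrakk> \<Longrightarrow> x = y"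
    and surj: "\<And>y. y \<in> inverse_limit_space P p \<Longrightarrow> \<exists>x\<in>X. \<forall>i. q i x = y i"
    and x0: "x0 \<in> X"
  defines "H \<equiv> \<lambda>i. fundamental_group (P i) (q i x0)"
  shows "\<exists>j>i. \<forall>l\<ge>j. \<exists>S\<subseteq>carrier (H l). finite S \<and>
    induced_map (P i) (p i j) ` carrier (H j) \<subseteq> induced_map (P i) (p i l) ` generate (H l) S"
proof -
  have p: "continuous_on (P j) (p i j)" "p i j ` P j \<subseteq> P i" if "i < j" for i j
    using seq that by (auto simp: inverse_sequence_spaces_def)
  have pp: "p i j (p j l x) = p i l x" if "i < j" "j < l" "x \<in> P l" for i j l x
    using seq that by (auto simp: inverse_sequence_spaces_def)
  have cX: "compact X" "connected X" "locally connected X" using X by (auto simp: peano_continuum_def)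
  show ?thesis
  proof (rule finite_polyhedron_close_paths_homotopic[OF poly[of i]])
    fix \<U>
    assume \<U>: "\<And>U. U \<in> \<U> \<Longrightarrow> openin (top_of_set (P i)) U" "P i \<subseteq> \<Union>\<U>"
      and homotopic: "\<And>f g. \<lbrakk>path f; path_image f \<subseteq> P i; path g; path_image g \<subseteq> P i; pathstart f = pathstart g;
         pathfinish f = pathfinish g; \<And>x. x \<in> {0..1} \<Longrightarrow> \<exists>U\<in>\<U>. f x \<in> U \<and> g x \<in> U\<rbrakk>
         \<Longrightarrow> homotopic_paths (P i) f g"
    show ?thesis
    proof (rule inverse_limit_fine_levels[where X = X and P = P and p = p and q = q and i = i and \<U> = \<U> and ?x0.0 = x0,
            OF cX(1,3) poly seq q pq inj surj \<U> x0])
      fix k j F U \<epsilon> and E :: "'b \<Rightarrow> nat \<Rightarrow> real"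
      assume ik: "i < k" and kj: "k < j" and E: "continuous_on (P k) E" and "0 < \<epsilon>"
        and F: "finite F" "F \<subseteq> X" "x0 \<in> F"
        and near: "\<And>w. w \<in> P j \<Longrightarrow> \<exists>z\<in>F. dist (E (p k j w)) (E (q k z)) < \<epsilon>/3"
        and U: "\<And>z. z \<in> F \<Longrightarrow> U z \<in> \<U>"
        and imU: "\<And>z w. \<lbrakk>z \<in> F; w \<in> P k; dist (E w) (E (q k z)) < \<epsilon>\<rbrakk> \<Longrightarrow> p i k w \<in> U z"
        and conn: "\<And>z y. \<lbrakk>z \<in> F; y \<in> F; dist (E (q k z)) (E (q k y)) < \<epsilon>\<rbrakk>
           \<Longrightarrow> \<exists>C. connected C \<and> C \<subseteq> X \<and> z \<in> C \<and> y \<in> C \<and> q i ` C \<subseteq> U z"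
      have ij: "i < j" using ik kj by simp
      show ?thesis
      proof (intro exI[of _ j] conjI allI impI ij)
        fix l assume "j \<le> l"
        then have il: "i < l" using ij by simp
        define close where "close z y \<longleftrightarrow> z \<in> F \<and> y \<in> F \<and> dist (E (q k z)) (E (q k y)) < \<epsilon>" for z y
        have qP: "q n z \<in> P n" if "z \<in> F" for n z using that F(2) q(2)[of n] by blast
        have qconn: "connected (q l ` C)" if "connected C" "C \<subseteq> X" for C
          using that q(1)[of l] by (meson connected_continuous_image continuous_on_subset)
        have "\<exists>s. path s \<and> path_image s \<subseteq> P l \<and> (\<forall>r\<in>{0..1}. p i l (s r) \<in> U z) \<and>
            pathstart s = q l z \<and> pathfinish s = q l y" if cl: "close z y" for z y
        proof -
          have zy: "z \<in> F" "y \<in> F" "dist (E (q k z)) (E (q k y)) < \<epsilon>" using cl by (auto simp: close_def)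
          obtain C where C: "connected C" "C \<subseteq> X" "z \<in> C" "y \<in> C" "q i ` C \<subseteq> U z"
            using conn[OF zy] by (elim exE conjE)
          \<comment> \<open>A path in \<open>P l\<close> that stays in this open set has its image
            in \<open>P i\<close> inside \<open>U z\<close>.\<close>
          let ?W = "P l \<inter> p i l -` U z"
          have W: "openin (top_of_set (P l)) ?W"
            using continuous_openin_preimage[OF p(1)[OF il] _ \<U>(1)[OF U[OF zy(1)]]] p(2)[OF il] by auto
          have CW: "q l ` C \<subseteq> ?W"
          proof (rule image_subsetI)
            fix c assume c: "c \<in> C"
            then have "c \<in> X" using C(2) by blast
            moreover have "q i c \<in> U z" using c C(5) by blast
            ultimately show "q l c \<in> ?W" using pq[OF il] q(2)[of l] by auto
          qed
          obtain s where s: "path s" "path_image s \<subseteq> ?W" "pathstart s = q l z" "pathfinish s = q l y"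
            by (rule finite_polyhedron_path_in_open_subset[OF poly[of l] W qconn[OF C(1,2)] CW imageI[OF C(3)] imageI[OF C(4)]])
          show ?thesis
            using s by (intro exI[of _ s]) (auto simp: path_image_def)
        qed
        then obtain s where s: "\<And>z y. close z y \<Longrightarrow> path (s z y)" "\<And>z y. close z y \<Longrightarrow> path_image (s z y) \<subseteq> P l"
          "\<And>z y r. close z y \<Longrightarrow> r \<in> {0..1} \<Longrightarrow> p i l (s z y r) \<in> U z"
          "\<And>z y. close z y \<Longrightarrow> pathstart (s z y) = q l z" "\<And>z y. close z y \<Longrightarrow> pathfinish (s z y) = q l y"
          by metis
        have "\<exists>t. path t \<and> path_image t \<subseteq> P l \<and> pathstart t = q l x0 \<and> pathfinish t = q l z" if "z \<in> F" for z
        proof -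
          have "z \<in> X" using that F(2) by blast
          obtain t where "path t" "path_image t \<subseteq> P l" "pathstart t = q l x0" "pathfinish t = q l z"
            by (rule finite_polyhedron_path_in_open_subset[OF poly[of l] openin_subtopology_self
                  qconn[OF cX(2) subset_refl] q(2) imageI[OF x0] imageI[OF \<open>z \<in> X\<close>]])
          then show ?thesis by blast
        qed
        then obtain t' where t': "\<And>z. z \<in> F \<Longrightarrow> path (t' z)" "\<And>z. z \<in> F \<Longrightarrow> path_image (t' z) \<subseteq> P l"
          "\<And>z. z \<in> F \<Longrightarrow> pathstart (t' z) = q l x0" "\<And>z. z \<in> F \<Longrightarrow> pathfinish (t' z) = q l z"
          by metis
        \<comment> \<open>The tail at \<open>x0\<close> is constant, as the telescoping product
          requires at both ends.\<close>
        define t where "t z = (if z = x0 then (\<lambda>_. q l x0) else t' z)" for z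
        have "path (\<lambda>_. q l x0)" by (simp add: path_def)
        then have t: "path (t z)" "path_image (t z) \<subseteq> P l" "pathstart (t z) = q l x0" "pathfinish (t z) = q l z"
          if "z \<in> F" for z
          using t'[OF that] qP[OF F(3)] by (auto simp: t_def path_image_def pathstart_def pathfinish_def)
        define gen where "gen = (\<lambda>(z, y). loop_class (P l) (t z +++ (s z y +++ reversepath (t y))))"
        define S where "S = gen ` {(z, y). close z y}"
        have "{(z, y). close z y} \<subseteq> F \<times> F" by (auto simp: close_def)
        then have "finite S" unfolding S_def using F(1) by (meson finite_SigmaI finite_imageI finite_subset)
        have SH: "S \<subseteq> carrier (H l)"
        proof
          fix A assume "A \<in> S"
          then obtain z y where zy: "close z y" "A = loop_class (P l) (t z +++ (s z y +++ reversepath (t y)))"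
            by (auto simp: S_def gen_def)
          have "z \<in> F" "y \<in> F" using zy(1) by (auto simp: close_def)
          then have "t z +++ (s z y +++ reversepath (t y)) \<in> loops_at (P l) (q l x0)"
            using s[OF zy(1)] t by (auto simp: loops_at_def path_image_join)
          then show "A \<in> carrier (H l)" by (simp add: H_def zy(2) carrier_fundamental_group)
        qed
        have "induced_map (P i) (p i j) A \<in> induced_map (P i) (p i l) ` generate (H l) S" if AH: "A \<in> carrier (H j)" for A
        proof -
          obtain f where A: "A = loop_class (P j) f" and f: "f \<in> loops_at (P j) (q j x0)"
            using AH by (auto simp: H_def carrier_fundamental_group)
          define g where "g = p k j \<circ> f"
          have fP: "f r \<in> P j" if "r \<in> {0..1}" for r using f that by (auto simp: loops_at_def path_image_def)
          have "g \<in> loops_at (P k) (p k j (q j x0))" unfolding g_def by (rule loops_at_compose[OF p[OF kj] f])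
          then have g: "path g" "path_image g \<subseteq> P k" "g 0 = q k x0" "g 1 = q k x0"
            using pq[OF kj x0] by (auto simp: loops_at_def pathstart_def pathfinish_def)
          have gP: "g r \<in> P k" if "r \<in> {0..1}" for r using g(2) that by (auto simp: path_image_def)
          have "continuous_on {0..1} (\<lambda>r. E (g r))"
            using continuous_on_compose2[OF E g(1)[unfolded path_def]] g(2) by (simp add: path_image_def)
          then have "uniformly_continuous_on {0..1} (\<lambda>r. E (g r))"
            by (rule compact_uniformly_continuous) simp
          moreover have "0 < \<epsilon>/3" using \<open>0 < \<epsilon>\<close> by simp
          ultimately obtain d where "0 < d" and d: "\<And>a b. \<lbrakk>a \<in> {0..1}; b \<in> {0..1}; dist b a < d\<rbrakk>
              \<Longrightarrow> dist (E (g b)) (E (g a)) < \<epsilon>/3"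
            unfolding uniformly_continuous_on_def by metis
          \<comment> \<open>The loop is cut into \<open>n\<close> cells, on each of which it stays
            within \<open>\<epsilon>/3\<close> of its value at the left end.\<close>
          obtain n where n: "0 < n" "1 / real n < d"
            using \<open>0 < d\<close> by (metis nat_approx_posE zero_less_Suc)
          have step: "dist (E (g ((real m + a) / real n))) (E (g (real m / real n))) < \<epsilon>/3"
            if "m < n" "a \<in> {0..1}" for m a
          proof (rule d)
            have "real m + a \<le> real n" using that by auto
            then show "(real m + a) / real n \<in> {0..1}" using that n(1) by auto
            show "real m / real n \<in> {0..1}" using that n(1) by auto
            have "dist ((real m + a) / real n) (real m / real n) = a / real n"
              using that by (simp add: dist_real_def add_divide_distrib)
            also have "\<dots> \<le> 1 / real n" using that by (simp add: divide_right_mono)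
            finally show "dist ((real m + a) / real n) (real m / real n) < d" using n(2) by simp
          qed
          have "\<exists>z\<in>F. dist (E (g (real m / real n))) (E (q k z)) < \<epsilon>/3" if "m \<le> n" for m
            using near[OF fP[of "real m / real n"]] that n(1) by (simp add: g_def)
          then obtain v' where v': "\<And>m. m \<le> n \<Longrightarrow> v' m \<in> F"
              "\<And>m. m \<le> n \<Longrightarrow> dist (E (g (real m / real n))) (E (q k (v' m))) < \<epsilon>/3"
            by metis
          \<comment> \<open>At both ends \<open>g\<close> is at the image of \<open>x0\<close>, so
            \<open>x0\<close> may replace the chosen point there, at distance 0.\<close>
          define v where "v m = (if m = 0 \<or> m = n then x0 else v' m)" for m
          have v: "v m \<in> F" "dist (E (g (real m / real n))) (E (q k (v m))) < \<epsilon>/3" if "m \<le> n" for m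
            using v' that F(3) g(3,4) n(1) \<open>0 < \<epsilon>\<close> by (auto simp: v_def)
          have vclose: "close (v m) (v (Suc m))" if "m < n" for m
          proof -
            have "dist (E (g (real (Suc m) / real n))) (E (g (real m / real n))) < \<epsilon>/3"
              using step[OF that, of 1] by (simp add: add.commute)
            moreover have "dist (E (g (real m / real n))) (E (q k (v m))) < \<epsilon>/3"
              "dist (E (g (real (Suc m) / real n))) (E (q k (v (Suc m)))) < \<epsilon>/3"
              using v(2)[of m] v(2)[of "Suc m"] that by auto
            ultimately have "dist (E (q k (v m))) (E (q k (v (Suc m)))) < \<epsilon>"
              by metric
            then show ?thesis using v(1) that by (simp add: close_def)
          qed
          obtain h where h: "h \<in> loops_at (P l) (q l x0)"
            "\<And>m r. m < n \<Longrightarrow> r \<in> {0..1} \<Longrightarrow> h ((real m + r) / real n) = s (v m) (v (Suc m)) r"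
            "loop_class (P l) h \<in> generate (fundamental_group (P l) (q l x0))
              ((\<lambda>m. loop_class (P l) (t (v m) +++ (s (v m) (v (Suc m)) +++ reversepath (t (v (Suc m)))))) ` {..<n})"
          proof (rule concatenated_loop[where n = n and s = "\<lambda>m. s (v m) (v (Suc m))" and t = "\<lambda>m. t (v m)"
                and v = "\<lambda>m. q l (v m)" and S = "P l" and x = "q l x0"])
            show "t (v 0) = (\<lambda>_. q l x0)" "t (v n) = (\<lambda>_. q l x0)" by (simp_all add: v_def t_def)
          qed (use n(1) s vclose t v(1) in simp_all)
          have "(\<lambda>m. loop_class (P l) (t (v m) +++ (s (v m) (v (Suc m)) +++ reversepath (t (v (Suc m)))))) ` {..<n} \<subseteq> S"
            using vclose by (auto simp: S_def gen_def)
          then have hgen: "loop_class (P l) h \<in> generate (H l) S"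
            using h(3) group.mono_generate[OF group_fundamental_group[OF qP[OF F(3)]]] unfolding H_def by blast
          have loops: "p i j \<circ> f \<in> loops_at (P i) (p i j (q j x0))" "p i l \<circ> h \<in> loops_at (P i) (p i l (q l x0))"
            by (rule loops_at_compose[OF p[OF ij] f], rule loops_at_compose[OF p[OF il] h(1)])
          \<comment> \<open>At a time in cell \<open>m\<close> both loops lie in
            \<open>U (v m)\<close>: the first because \<open>g\<close> is then within two thirds of
            \<open>\<epsilon>\<close> of the image of \<open>v m\<close>, the second by the choice
            of the pieces \<open>s\<close>.\<close>
          have "homotopic_paths (P i) (p i j \<circ> f) (p i l \<circ> h)"
          proof (rule homotopic)
            show "path (p i j \<circ> f)" "path_image (p i j \<circ> f) \<subseteq> P i" "path (p i l \<circ> h)" "path_image (p i l \<circ> h) \<subseteq> P i"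
              using loops by (auto simp: loops_at_def)
            show "pathstart (p i j \<circ> f) = pathstart (p i l \<circ> h)" "pathfinish (p i j \<circ> f) = pathfinish (p i l \<circ> h)"
              using loops pq[OF ij x0] pq[OF il x0] by (auto simp: loops_at_def)
            fix r :: real assume r: "r \<in> {0..1}"
            obtain m a where ma: "m < n" "a \<in> {0..1}" "r = (real m + a) / real n"
              by (rule interval_cell[OF n(1) r])
            have vm: "v m \<in> F" "dist (E (g (real m / real n))) (E (q k (v m))) < \<epsilon>/3" using v[of m] ma(1) by auto
            have "dist (E (g r)) (E (g (real m / real n))) < \<epsilon>/3" using step[OF ma(1,2)] ma(3) by simp
            then have "dist (E (g r)) (E (q k (v m))) < \<epsilon>" using vm(2) \<open>0 < \<epsilon>\<close> by metric
            then have "p i k (g r) \<in> U (v m)" by (rule imU[OF vm(1) gP[OF r]])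
            then have "(p i j \<circ> f) r \<in> U (v m)" using pp[OF ik kj fP[OF r]] by (simp add: g_def)
            moreover have "(p i l \<circ> h) r \<in> U (v m)"
              using s(3)[OF vclose[OF ma(1)] ma(2)] h(2)[OF ma(1,2)] ma(3) by simp
            ultimately show "\<exists>U\<in>\<U>. (p i j \<circ> f) r \<in> U \<and> (p i l \<circ> h) r \<in> U" using U[OF vm(1)] by blast
          qed
          then have "loop_class (P i) (p i j \<circ> f) = loop_class (P i) (p i l \<circ> h)"
            by (rule iffD2[OF loop_class_eq_iff[OF loops(1)]])
          then have "induced_map (P i) (p i j) A = induced_map (P i) (p i l) (loop_class (P l) h)"
            unfolding A induced_map_loop_class[OF p[OF ij] f] induced_map_loop_class[OF p[OF il] h(1)] .
          then show ?thesis using hgen by blast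
        qed
        then show "\<exists>S\<subseteq>carrier (H l). finite S \<and>
          induced_map (P i) (p i j) ` carrier (H j) \<subseteq> induced_map (P i) (p i l) ` generate (H l) S"
          using SH \<open>finite S\<close> by blast
      qed
    qed
  qed
qed

theorem corollary4:
  fixes X :: "'a::metric_space set"
    and P :: "nat \<Rightarrow> 'b::topological_space set"
    and p :: "nat \<Rightarrow> nat \<Rightarrow> 'b \<Rightarrow> 'b"
    and q :: "nat \<Rightarrow> 'a \<Rightarrow> 'b"
    and x0 :: 'a
    and G :: "('g, 'm) monoid_scheme"
  assumes "peano_continuum X"
    and "\<And>i. finite_polyhedron (P i)"
    and "inverse_sequence_spaces P p"
    and "is_inverse_limit X q P p"
    and "x0 \<in> X"
    and "group G"
    and "countable (carrier G)"
    and "inverse_limit_slender TYPE('h::infinite) G"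
  shows "countable (homomorphisms (first_shape_group P p q x0) G)"
proof -
  let ?q = "\<lambda>x i. q i x"
  obtain r where r: "homeomorphism X (inverse_limit_space P p) ?q r"
    using assms(4) by (auto simp: is_inverse_limit_def)
  have lim: "?q x \<in> inverse_limit_space P p" if "x \<in> X" for x
    using homeomorphism_image1[OF r] that by blast
  have cq: "continuous_on X (q i)" for i
    using r continuous_on_product_then_coordinatewise[of X ?q i] by (simp add: homeomorphism_def)
  have qP: "q i ` X \<subseteq> P i" for i
    using lim by (auto simp: inverse_limit_space_def)
  have pq: "p i j (q j x) = q i x" if "i < j" "x \<in> X" for i j x
    using lim[OF that(2)] that(1) by (auto simp: inverse_limit_space_def)
  have inj: "x = y" if "x \<in> X" "y \<in> X" "\<And>i. q i x = q i y" for x y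
  proof -
    have "?q x = ?q y" by (rule ext) (rule that(3))
    then have "r (?q x) = r (?q y)" by (rule arg_cong)
    then show ?thesis unfolding homeomorphism_apply1[OF r that(1)] homeomorphism_apply1[OF r that(2)] .
  qed
  have surj: "\<exists>x\<in>X. \<forall>i. q i x = y i" if "y \<in> inverse_limit_space P p" for y
  proof -
    have "y \<in> ?q ` X" using that unfolding homeomorphism_image1[OF r] .
    then show ?thesis by auto
  qed
  show ?thesis
    unfolding first_shape_group_def
  proof (rule countable_homomorphisms_inverse_limit[OF assms(6,7,8)])
    show "inverse_sequence_groups (\<lambda>i. fundamental_group (P i) (q i x0)) (\<lambda>i j. induced_map (P i) (p i j))"
      using qP assms(5) pq by (intro inverse_sequence_fundamental_groups[OF assms(3)]) auto
    show "\<exists>j>i. \<forall>k\<ge>j. \<exists>S\<subseteq>carrier (fundamental_group (P k) (q k x0)). finite S \<and>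
        induced_map (P i) (p i j) ` carrier (fundamental_group (P j) (q j x0))
        \<subseteq> induced_map (P i) (p i k) ` generate (fundamental_group (P k) (q k x0)) S" for i
      by (rule inverse_limit_fundamental_group_images[OF assms(1-3) cq qP pq inj surj assms(5)])
  qed
qed

end
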